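(* Assume that $f$ is Lipschitz continuous on $\mathcal S_d$. Let $s\in\mathrm{Int}(\mathcal S_d)$ be such that $f(s)>0$. If $n^{1/2}b^{d/4}\to\infty$ as $n\to\infty$ and $b\to0$, then $$n^{1/2}b^{d/4}\bigl(\hat f_{n,b}(s)-f_b(s)\bigr)\longrightarrow\mathcal N\bigl(0,\psi(s)f(s)\bigr)\quad\text{in distribution.}$$ If we also have $n^{1/2}b^{d/4+1/2}\to0$ as $n\to\infty$ and $b\to0$, then $$n^{1/2}b^{d/4}\bigl(\hat f_{n,b}(s)-f(s)\bigr)\longrightarrow\mathcal N\bigl(0,\psi(s)f(s)\bigr)\quad\text{in distribution.}$$ Independently of the rate conditions $n^{1/2}b^{d/4}\to\infty$ and $n^{1/2}b^{d/4+1/2}\to0$ (that is, without imposing either of them as a hypothesis), if we assume instead that $f$ is twice continuously differentiable on $\mathcal S_d$ and that $n^{2/(d+4)}b\to\lambda$ for some $\lambda>0$ as $n\to\infty$ and $b\to0$, then $$n^{2/(d+4)}\bigl(\hat f_{n,b}(s)-f(s)\bigr)\longrightarrow\mathcal N\bigl(\lambda\,g(s),\lambda^{-d/2}\psi(s)f(s)\bigr)\quad\text{in distribution.}$$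
   Context: Let $d\in\mathbb N$, $[d]=\{1,\dots,d\}$, $\|s\|_1=\sum_{i=1}^d|s_i|$, $\mathcal S_d=\{s\in[0,1]^d:\|s\|_1\le1\}$ and $\mathrm{Int}(\mathcal S_d)=\{s\in(0,1)^d:\|s\|_1<1\}$. For $\alpha\in(0,\infty)^d$ and $\beta>0$, the Dirichlet$(\alpha,\beta)$ density on $\mathcal S_d$ is $$K_{\alpha,\beta}(s)=\frac{\Gamma(\|\alpha\|_1+\beta)}{\Gamma(\beta)\prod_{i=1}^d\Gamma(\alpha_i)}(1-\|s\|_1)^{\beta-1}\prod_{i=1}^ds_i^{\alpha_i-1}.$$ Let $X_1,X_2,\dots$ be i.i.d. random vectors with a density $f$ supported on $\mathcal S_d$. The bandwidth $b=b(n)>0$ is a function of $n$. The Dirichlet kernel estimator is $$\hat f_{n,b}(s)=\frac1n\sum_{i=1}^nK_{s/b+1,\,(1-\|s\|_1)/b+1}(X_i),\qquad s\in\mathcal S_d,$$ where $s/b+1=(s_1/b+1,\dots,s_d/b+1)$, and $f_b(s)=\mathbb E[\hat f_{n,b}(s)]$. Put $$\psi(s)=\Bigl[(4\pi)^d(1-\|s\|_1)\prod_{i\in[d]}s_i\Bigr]^{-1/2},$$ $$g(s)=\sum_{i\in[d]}(1-(d+1)s_i)\frac{\partial}{\partial s_i}f(s)+\frac12\sum_{i,j\in[d]}s_i(\mathbf 1_{\{i=j\}}-s_j)\frac{\partial^2}{\partial s_i\partial s_j}f(s).$$ $\mathcal N(\mu,\sigma^2)$ is the normal distribution with mean $\mu$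 and variance $\sigma^2$. *)

theory Defs
  imports "HOL-Probability.Probability"
begin

text \<open>
  Points of R^d are elements of \<open>real ^ 'd\<close>, where \<open>'d\<close> is an arbitrary (nonempty) finite type and
  d is \<open>CARD('d)\<close>.
\<close>

definition l1_norm :: "real ^ 'd \<Rightarrow> real" where
  "l1_norm s = (\<Sum>i\<in>UNIV. \<bar>s $ i\<bar>)"

definition simplex_set :: "(real ^ 'd) set" where
  "simplex_set = {s. (\<forall>i. s $ i \<in> {0..1}) \<and> l1_norm s \<le> 1}"

definition simplex_int :: "(real ^ 'd) set" where
  "simplex_int = {s. (\<forall>i. s $ i \<in> {0<..<1}) \<and> l1_norm s < 1}"

text \<open>
  The density is extended by 0 to all of R^d. On the boundary of the simplex, where a factor may
  be \<open>0 powr 0\<close> or a negative power of 0, \<open>powr\<close> makes the value 0; this affects a null set only.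
\<close>

definition dirichlet_density :: "real ^ 'd \<Rightarrow> real \<Rightarrow> real ^ 'd \<Rightarrow> real" where
  "dirichlet_density \<alpha> \<beta> s =
     (if s \<in> simplex_set
      then Gamma (l1_norm \<alpha> + \<beta>) / (Gamma \<beta> * (\<Prod>i\<in>UNIV. Gamma (\<alpha> $ i)))
           * (1 - l1_norm s) powr (\<beta> - 1) * (\<Prod>i\<in>UNIV. (s $ i) powr (\<alpha> $ i - 1))
      else 0)"

text \<open>The sample is \<open>X 1, X 2, \<dots>\<close>; the value \<open>X 0\<close> is never used.\<close>

definition dirichlet_kde ::
  "(nat \<Rightarrow> 'a \<Rightarrow> real ^ 'd) \<Rightarrow> nat \<Rightarrow> real \<Rightarrow> real ^ 'd \<Rightarrow> 'a \<Rightarrow> real" where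
  "dirichlet_kde X n b s \<omega> =
     1 / real n * (\<Sum>i = 1..n.
       dirichlet_density (\<chi> j. s $ j / b + 1) ((1 - l1_norm s) / b + 1) (X i \<omega>))"

definition dirichlet_kde_mean ::
  "'a measure \<Rightarrow> (nat \<Rightarrow> 'a \<Rightarrow> real ^ 'd) \<Rightarrow> nat \<Rightarrow> real \<Rightarrow> real ^ 'd \<Rightarrow> real" where
  "dirichlet_kde_mean M X n b s = (\<integral>\<omega>. dirichlet_kde X n b s \<omega> \<partial>M)"

definition psi :: "real ^ 'd \<Rightarrow> real" where
  "psi s = ((4 * pi) ^ CARD('d) * (1 - l1_norm s) * (\<Prod>i\<in>UNIV. s $ i)) powr (- 1 / 2)"

definition partial_deriv :: "'d \<Rightarrow> (real ^ 'd \<Rightarrow> real) \<Rightarrow> real ^ 'd \<Rightarrow> real" where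
  "partial_deriv i f s = deriv (\<lambda>t. f (s + t *\<^sub>R axis i 1)) 0"

definition bias_coeff :: "(real ^ 'd \<Rightarrow> real) \<Rightarrow> real ^ 'd \<Rightarrow> real" where
  "bias_coeff f s =
     (\<Sum>i\<in>UNIV. (1 - (real CARD('d) + 1) * s $ i) * partial_deriv i f s)
     + 1 / 2 * (\<Sum>i\<in>UNIV. \<Sum>j\<in>UNIV.
         s $ i * (of_bool (i = j) - s $ j) * partial_deriv i (partial_deriv j f) s)"

text \<open>
  \<open>G\<close> is the gradient and \<open>H\<close> the Hessian matrix. Derivatives are taken within \<open>S\<close>, so they are
  one-sided on the boundary of the simplex and the values of \<open>f\<close> outside \<open>S\<close> play no role.
\<close>

definition twice_cont_differentiable_on ::
  "(real ^ 'd \<Rightarrow> real) \<Rightarrow> (real ^ 'd) set \<Rightarrow> bool" where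
  "twice_cont_differentiable_on f S \<longleftrightarrow>
     (\<exists>(G :: real ^ 'd \<Rightarrow> real ^ 'd) (H :: real ^ 'd \<Rightarrow> real ^ 'd ^ 'd).
        (\<forall>x\<in>S. (f has_derivative (\<lambda>h. G x \<bullet> h)) (at x within S)) \<and>
        (\<forall>x\<in>S. (G has_derivative (\<lambda>h. H x *v h)) (at x within S)) \<and>
        continuous_on S H)"

text \<open>The second parameter is the variance, which has to be positive.\<close>

definition normal_distribution :: "real \<Rightarrow> real \<Rightarrow> real measure" where
  "normal_distribution \<mu> v = density lborel (\<lambda>x. ennreal (normal_density \<mu> (sqrt v) x))"

definition tendsto_in_distribution ::
  "'a measure \<Rightarrow> (nat \<Rightarrow> 'a \<Rightarrow> real) \<Rightarrow> real measure \<Rightarrow> bool" where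
  "tendsto_in_distribution M Y N \<longleftrightarrow> weak_conv_m (\<lambda>n. distr M borel (Y n)) N"

end

theory Submission
  imports Defs "HOL-Real_Asymp.Real_Asymp"
begin

text \<open>
  Write \<open>K\<^sub>b\<close> for the Dirichlet kernel with bandwidth \<open>b\<close> at the fixed interior point \<open>s\<close>.
  The estimator is the mean of the independent, identically distributed variables \<open>K\<^sub>b(X\<^sub>i)\<close>, so
  asymptotic normality is a matter of a central limit theorem for triangular arrays, of the second and
  fourth moments of \<open>K\<^sub>b(X\<^sub>i)\<close>, and of the bias \<open>E K\<^sub>b(X\<^sub>1) - f(s)\<close>.

  What makes all moments accessible is that the exponents of the kernel are exactly proportional to
  \<open>1 / b\<close>: the square of \<open>K\<^sub>b\<close> is a constant \<open>A\<^sub>b\<close> (below \<open>kernel_energy\<close>) times \<open>K\<^sub>b\<^sub>/\<^sub>2\<close>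
  (\<open>dirichlet_kernel_power2\<close>). Every power \<open>K\<^sub>b\<^sup>2\<close>, \<open>K\<^sub>b\<^sup>4\<close> is thus, up to a constant, again a
  Dirichlet kernel, and \<open>E K\<^sub>b(X)\<^sup>2 = A\<^sub>b E f(\<xi>)\<close> where \<open>\<xi>\<close> has the density \<open>K\<^sub>b\<^sub>/\<^sub>2\<close>. Since \<open>\<xi>\<close> concentrates
  at \<open>s\<close>, the factor \<open>E f(\<xi>)\<close> tends to \<open>f(s)\<close>. The constant \<open>A\<^sub>b\<close> is a quotient of Gamma functions in which each factor
  \<open>\<Gamma>(2z + 1) / \<Gamma>(z + 1)\<^sup>2\<close> reduces, by Legendre's duplication formula, to
  \<open>\<Gamma>(z + 1/2) / \<Gamma>(z) \<sim> \<surd>z\<close>; the exponential factors cancel because the barycentric coordinates of \<open>s\<close>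
  sum to 1. This gives \<open>b\<^sup>d\<^sup>/\<^sup>2 A\<^sub>b \<longlonglongrightarrow> \<psi>(s)\<close> (\<open>kernel_energy_asymptotics\<close>) without Stirling's
  formula or a Gaussian integral.

  Hence \<open>E K\<^sub>b(X)\<^sup>2\<close> is of order \<open>b\<^sup>-\<^sup>d\<^sup>/\<^sup>2\<close> and \<open>E K\<^sub>b(X)\<^sup>4\<close> of order \<open>b\<^sup>-\<^sup>3\<^sup>d\<^sup>/\<^sup>2\<close>, and Lyapunov's condition with
  fourth moments holds as soon as \<open>n b\<^sup>d\<^sup>/\<^sup>2\<close> tends to infinity (\<open>lyapunov_clt_triangular\<close>,
  \<open>dirichlet_kde_clt\<close>).

  The Dirichlet integral holds because the power functions \<open>y\<^sup>a\<^sup>-\<^sup>1 / \<Gamma>(a)\<close> form a convolution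
  semigroup; multiplying a Dirichlet density by a coordinate shifts one parameter by 1, so the polynomial moments of a variable \<open>\<xi>\<close> with density \<open>K\<^sub>b\<close> are explicit
  rational functions of \<open>b\<close>. The first and second moments of \<open>\<xi> - s\<close> are of order \<open>b\<close> and the fourth moments
  are \<open>o(b)\<close>, which gives the bias: \<open>O(\<surd>b)\<close> for Lipschitz \<open>f\<close>
  (\<open>kernel_bias_lipschitz\<close>), and \<open>b g(s) + o(b)\<close> for twice continuously differentiable \<open>f\<close>, by a second-order
  Taylor expansion (\<open>kernel_bias_C2\<close>).
\<close>

section \<open>The Dirichlet integral\<close>

text \<open>
  The kernel of the Riemann--Liouville fractional integral of order \<open>a\<close>, supported on the half-line.
  With this normalisation the Dirichlet density is a product of such factors, up to one constant.
\<close>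

definition gamma_power :: "real \<Rightarrow> real \<Rightarrow> real" where
  "gamma_power a y = indicator {0..} y * y powr (a - 1) / Gamma a"

lemma gamma_power_measurable [measurable]: "gamma_power a \<in> borel_measurable borel"
  unfolding gamma_power_def by measurable

lemma gamma_power_nonneg: "a > 0 \<Longrightarrow> 0 \<le> gamma_power a y"
  unfolding gamma_power_def by (simp add: Gamma_real_nonneg)

text \<open>
  After scaling to the unit interval this is the Beta integral. The point \<open>t = 0\<close> has to be excluded
  because \<open>0 powr 0 = 0\<close>.
\<close>

lemma gamma_power_convolution:
  assumes "a > 0" "c > 0" "t \<noteq> 0"
  shows "(\<integral>\<^sup>+y. ennreal (gamma_power a y) * ennreal (gamma_power c (t - y)) \<partial>lborel)
         = ennreal (gamma_power (a + c) t)"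
proof (cases "t > 0")
  case False
  have "gamma_power a y * gamma_power c (t - y) = 0" for y
    using assms False by (auto simp: gamma_power_def indicator_def)
  moreover have "gamma_power (a + c) t = 0"
    using assms False by (auto simp: gamma_power_def indicator_def)
  ultimately show ?thesis
    using assms by (simp only: ennreal_mult'[symmetric] gamma_power_nonneg) simp
next
  case t: True
  have unit: "(\<integral>\<^sup>+y. ennreal (y powr (a - 1) * (1 - y) powr (c - 1) * indicator {0..1} y) \<partial>lborel)
               = ennreal (Beta a c)"
    using nn_integral_has_integral_lebesgue[OF _ has_integral_Beta_real[OF assms(1,2)]]
    by (simp add: mult_ac)
  have *: "gamma_power a (t * y) * gamma_power c (t - t * y) =
      t powr (a + c - 2) / (Gamma a * Gamma c)
      * (y powr (a - 1) * (1 - y) powr (c - 1) * indicator {0..1} y)" for y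
  proof (cases "y \<in> {0..1}")
    case True
    then have "(t * y) powr (a - 1) * (t * (1 - y)) powr (c - 1)
        = (t powr (a - 1) * t powr (c - 1)) * (y powr (a - 1) * (1 - y) powr (c - 1))"
      using t by (simp add: powr_mult)
    also have "t powr (a - 1) * t powr (c - 1) = t powr (a + c - 2)"
      by (simp add: powr_add[symmetric])
    finally have "(t * y) powr (a - 1) * (t * (1 - y)) powr (c - 1)
        = t powr (a + c - 2) * (y powr (a - 1) * (1 - y) powr (c - 1))" .
    moreover have "t - t * y \<ge> 0"
      using True t by (simp add: mult_left_le)
    ultimately show ?thesis
      using True t unfolding gamma_power_def
      by (simp add: right_diff_distrib zero_le_mult_iff add_ac)
  next
    case False
    moreover have "\<not> (0 \<le> t * y \<and> 0 \<le> t - t * y)"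
      using t False by (auto simp: zero_le_mult_iff)
    ultimately show ?thesis
      by (auto simp: gamma_power_def indicator_def)
  qed
  have nn: "0 \<le> t powr (a + c - 2) / (Gamma a * Gamma c)"
    using assms by (simp add: Gamma_real_nonneg)
  have "(\<integral>\<^sup>+y. ennreal (gamma_power a y) * ennreal (gamma_power c (t - y)) \<partial>lborel)
        = (\<integral>\<^sup>+y. ennreal (gamma_power a y * gamma_power c (t - y)) \<partial>lborel)"
    using assms by (simp add: ennreal_mult' gamma_power_nonneg)
  also have "\<dots> = ennreal t *
      (\<integral>\<^sup>+y. ennreal (gamma_power a (t * y) * gamma_power c (t - t * y)) \<partial>lborel)"
    using t by (subst nn_integral_real_affine[where c = t and t = 0]) auto
  also have "\<dots> = ennreal t * (ennreal (t powr (a + c - 2) / (Gamma a * Gamma c)) * ennreal (Beta a c))"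
    unfolding * ennreal_mult'[OF nn] by (subst nn_integral_cmult) (auto simp: unit)
  also have "\<dots> = ennreal (t * (t powr (a + c - 2) / (Gamma a * Gamma c) * Beta a c))"
    unfolding ennreal_mult'[OF nn, symmetric] using t by (intro ennreal_mult'[symmetric]) simp
  also have "t * (t powr (a + c - 2) / (Gamma a * Gamma c) * Beta a c) = gamma_power (a + c) t"
  proof -
    have "t * t powr (a + c - 2) = t powr (a + c - 1)"
      using t powr_add[of t 1 "a + c - 2"] by simp
    moreover have "Gamma a > 0" "Gamma c > 0"
      using assms by auto
    ultimately show ?thesis
      using t by (simp add: gamma_power_def Beta_def)
  qed
  finally show ?thesis .
qed

text \<open>
  The coordinates are integrated out one at a time, each step being one convolution. The bound \<open>t\<close>
  varies in the induction: fixing one coordinate at \<open>y\<close> leaves a simplex of size \<open>t - y\<close>, and the value \<open>y = t\<close>,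
  where the convolution formula fails, is a null set.
\<close>

lemma nn_integral_gamma_power_PiM:
  assumes "finite I" "\<And>i. i \<in> I \<Longrightarrow> a i > 0" "c > 0" "t \<noteq> 0"
  shows "(\<integral>\<^sup>+x. (\<Prod>i\<in>I. ennreal (gamma_power (a i) (x i)))
              * ennreal (gamma_power c (t - (\<Sum>i\<in>I. x i))) \<partial>(\<Pi>\<^sub>M i\<in>I. lborel))
         = ennreal (gamma_power ((\<Sum>i\<in>I. a i) + c) t)"
  using assms
proof (induction I arbitrary: t rule: finite_induct)
  case empty
  then show ?case
    by (simp add: PiM_empty nn_integral_count_space_finite)
next
  case (insert i I)
  interpret product_sigma_finite "\<lambda>_. lborel :: real measure"
    by (simp add: product_sigma_finite_def sigma_finite_lborel)
  define A where "A = (\<Sum>i\<in>I. a i)"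
  have A: "A \<ge> 0"
    using insert.prems unfolding A_def by (intro sum_nonneg less_imp_le) auto
  have "(\<integral>\<^sup>+x. (\<Prod>j\<in>insert i I. ennreal (gamma_power (a j) (x j)))
              * ennreal (gamma_power c (t - (\<Sum>j\<in>insert i I. x j))) \<partial>(\<Pi>\<^sub>M i\<in>insert i I. lborel))
      = (\<integral>\<^sup>+y. (\<integral>\<^sup>+x. (\<Prod>j\<in>insert i I. ennreal (gamma_power (a j) ((x(i := y)) j)))
              * ennreal (gamma_power c (t - (\<Sum>j\<in>insert i I. (x(i := y)) j))) \<partial>(\<Pi>\<^sub>M i\<in>I. lborel)) \<partial>lborel)"
    using insert.hyps by (subst product_nn_integral_insert_rev) auto
  also have "\<dots> = (\<integral>\<^sup>+y. (\<integral>\<^sup>+x. ennreal (gamma_power (a i) y) * ((\<Prod>j\<in>I. ennreal (gamma_power (a j) (x j)))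
              * ennreal (gamma_power c ((t - y) - (\<Sum>j\<in>I. x j)))) \<partial>(\<Pi>\<^sub>M i\<in>I. lborel)) \<partial>lborel)"
  proof (intro nn_integral_cong)
    fix y :: real and x :: "'a \<Rightarrow> real"
    have 1: "(\<Prod>j\<in>I. ennreal (gamma_power (a j) ((x(i := y)) j))) = (\<Prod>j\<in>I. ennreal (gamma_power (a j) (x j)))"
      using insert.hyps by (intro prod.cong) auto
    have 2: "(\<Sum>j\<in>I. (x(i := y)) j) = (\<Sum>j\<in>I. x j)"
      using insert.hyps by (intro sum.cong) auto
    show "(\<Prod>j\<in>insert i I. ennreal (gamma_power (a j) ((x(i := y)) j)))
              * ennreal (gamma_power c (t - (\<Sum>j\<in>insert i I. (x(i := y)) j)))
       = ennreal (gamma_power (a i) y) * ((\<Prod>j\<in>I. ennreal (gamma_power (a j) (x j)))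
              * ennreal (gamma_power c ((t - y) - (\<Sum>j\<in>I. x j))))"
      unfolding prod.insert[OF insert.hyps] sum.insert[OF insert.hyps] 1 2
      by (simp add: mult_ac diff_diff_eq)
  qed
  also have "\<dots> = (\<integral>\<^sup>+y. ennreal (gamma_power (a i) y) * ennreal (gamma_power (A + c) (t - y)) \<partial>lborel)"
  proof (rule nn_integral_cong_AE)
    have "AE y in lborel. y \<noteq> t"
      by (rule AE_lborel_singleton)
    then show "AE y in lborel. (\<integral>\<^sup>+x. ennreal (gamma_power (a i) y) * ((\<Prod>j\<in>I. ennreal (gamma_power (a j) (x j)))
              * ennreal (gamma_power c ((t - y) - (\<Sum>j\<in>I. x j)))) \<partial>(\<Pi>\<^sub>M i\<in>I. lborel))
           = ennreal (gamma_power (a i) y) * ennreal (gamma_power (A + c) (t - y))"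
    proof eventually_elim
      case (elim y)
      then show ?case
        using insert.IH[of "t - y"] insert.prems insert.hyps
        by (subst nn_integral_cmult) (auto simp: A_def)
    qed
  qed
  also have "\<dots> = ennreal (gamma_power (a i + (A + c)) t)"
    using A insert.prems by (intro gamma_power_convolution) auto
  also have "a i + (A + c) = (\<Sum>j\<in>insert i I. a j) + c"
    using insert.hyps by (simp add: A_def)
  finally show ?case .
qed

lemma Basis_vec_real: "(Basis :: (real ^ 'd) set) = range (\<lambda>i. axis i 1)"
  by (auto simp: Basis_vec_def)

lemma inj_axis_one: "inj (\<lambda>i. axis i (1::real) :: real ^ 'd)"
  by (auto simp: inj_on_def axis_eq_axis)

lemma nn_integral_gamma_power_vec:
  fixes \<alpha> :: "real ^ 'd"
  assumes "\<And>i. \<alpha> $ i > 0" "c > 0" "t \<noteq> 0"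
  shows "(\<integral>\<^sup>+x. ennreal ((\<Prod>i\<in>UNIV. gamma_power (\<alpha> $ i) (x $ i)) * gamma_power c (t - (\<Sum>i\<in>UNIV. x $ i)))
            \<partial>(lborel :: (real ^ 'd) measure))
         = ennreal (gamma_power ((\<Sum>i\<in>UNIV. \<alpha> $ i) + c) t)"
proof -
  let ?B = "Basis :: (real ^ 'd) set"
  have sums: "(\<Sum>b\<in>?B. g (v \<bullet> b)) = (\<Sum>i\<in>UNIV. g (v $ i))" for g :: "real \<Rightarrow> real" and v
    unfolding Basis_vec_real by (subst sum.reindex[OF inj_axis_one]) (simp add: inner_axis)
  have prods: "(\<Prod>b\<in>?B. ennreal (gamma_power (\<alpha> \<bullet> b) (v \<bullet> b))) = (\<Prod>i\<in>UNIV. ennreal (gamma_power (\<alpha> $ i) (v $ i)))" for v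
    unfolding Basis_vec_real by (subst prod.reindex[OF inj_axis_one]) (simp add: inner_axis)
  have "(\<integral>\<^sup>+x. ennreal ((\<Prod>i\<in>UNIV. gamma_power (\<alpha> $ i) (x $ i)) * gamma_power c (t - (\<Sum>i\<in>UNIV. x $ i))) \<partial>lborel)
      = (\<integral>\<^sup>+x. (\<Prod>b\<in>?B. ennreal (gamma_power (\<alpha> \<bullet> b) (x \<bullet> b))) * ennreal (gamma_power c (t - (\<Sum>b\<in>?B. x \<bullet> b))) \<partial>lborel)"
    unfolding prods sums[of "\<lambda>x. x"]
    using assms by (subst prod_ennreal) (auto simp: gamma_power_nonneg ennreal_mult' prod_nonneg)
  also have "\<dots> = (\<integral>\<^sup>+x. (\<Prod>b\<in>?B. ennreal (gamma_power (\<alpha> \<bullet> b) (x b))) * ennreal (gamma_power c (t - (\<Sum>b\<in>?B. x b)))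
      \<partial>(\<Pi>\<^sub>M b\<in>?B. lborel))"
  proof (subst lborel_eq, subst nn_integral_distr)
    show "(\<integral>\<^sup>+x. (\<Prod>b\<in>?B. ennreal (gamma_power (\<alpha> \<bullet> b) ((\<Sum>b\<in>?B. x b *\<^sub>R b) \<bullet> b)))
             * ennreal (gamma_power c (t - (\<Sum>b\<in>?B. (\<Sum>b\<in>?B. x b *\<^sub>R b) \<bullet> b))) \<partial>(\<Pi>\<^sub>M b\<in>?B. lborel))
      = (\<integral>\<^sup>+x. (\<Prod>b\<in>?B. ennreal (gamma_power (\<alpha> \<bullet> b) (x b))) * ennreal (gamma_power c (t - (\<Sum>b\<in>?B. x b)))
          \<partial>(\<Pi>\<^sub>M b\<in>?B. lborel))"
      by (simp add: inner_sum_left inner_Basis if_distrib cong: if_cong)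
  qed measurable
  also have "\<dots> = ennreal (gamma_power ((\<Sum>b\<in>?B. \<alpha> \<bullet> b) + c) t)"
    using assms by (intro nn_integral_gamma_power_PiM) (auto simp: Basis_vec_real inner_axis)
  finally show ?thesis
    unfolding sums[of "\<lambda>x. x"] .
qed

lemma l1_norm_nonneg_vec: "(\<And>i. 0 \<le> x $ i) \<Longrightarrow> l1_norm x = (\<Sum>i\<in>UNIV. x $ i)"
  by (simp add: l1_norm_def)

lemma simplex_set_iff: "x \<in> simplex_set \<longleftrightarrow> (\<forall>i. 0 \<le> x $ i) \<and> (\<Sum>i\<in>UNIV. x $ i) \<le> 1"
proof
  assume "x \<in> simplex_set"
  then show "(\<forall>i. 0 \<le> x $ i) \<and> (\<Sum>i\<in>UNIV. x $ i) \<le> 1"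
    by (auto simp: simplex_set_def l1_norm_def)
next
  assume *: "(\<forall>i. 0 \<le> x $ i) \<and> (\<Sum>i\<in>UNIV. x $ i) \<le> 1"
  have "x $ i \<le> (\<Sum>i\<in>UNIV. x $ i)" for i
    using * by (intro member_le_sum) auto
  then show "x \<in> simplex_set"
    using * by (auto simp: simplex_set_def l1_norm_def intro: order_trans)
qed

lemma dirichlet_density_eq_gamma_power:
  assumes "\<And>i. \<alpha> $ i > 0" "c > 0"
  shows "dirichlet_density \<alpha> c x = Gamma ((\<Sum>i\<in>UNIV. \<alpha> $ i) + c)
     * ((\<Prod>i\<in>UNIV. gamma_power (\<alpha> $ i) (x $ i)) * gamma_power c (1 - (\<Sum>i\<in>UNIV. x $ i)))"
proof (cases "x \<in> simplex_set")
  case True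
  then have x: "\<And>i. 0 \<le> x $ i" "(\<Sum>i\<in>UNIV. x $ i) \<le> 1"
    by (auto simp: simplex_set_iff)
  show ?thesis
    using True x assms unfolding dirichlet_density_def gamma_power_def
    by (simp add: l1_norm_nonneg_vec less_imp_le prod_dividef prod.distrib mult_ac)
next
  case False
  then consider i where "x $ i < 0" | "1 - (\<Sum>i\<in>UNIV. x $ i) < 0"
    by (auto simp: simplex_set_iff not_le)
  then have "(\<Prod>i\<in>UNIV. gamma_power (\<alpha> $ i) (x $ i)) * gamma_power c (1 - (\<Sum>i\<in>UNIV. x $ i)) = 0"
  proof cases
    case (1 i)
    then have "gamma_power (\<alpha> $ i) (x $ i) = 0"
      by (simp add: gamma_power_def)
    then have "(\<Prod>i\<in>UNIV. gamma_power (\<alpha> $ i) (x $ i)) = 0"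
      by (intro prod_zero) auto
    then show ?thesis
      by simp
  qed (simp add: gamma_power_def)
  then show ?thesis
    using False by (simp add: dirichlet_density_def)
qed

lemma dirichlet_density_measurable [measurable]:
  assumes "\<And>i. \<alpha> $ i > 0" "c > 0"
  shows "dirichlet_density \<alpha> c \<in> borel_measurable borel"
  unfolding dirichlet_density_eq_gamma_power[OF assms, abs_def] by measurable

lemma dirichlet_density_nonneg:
  assumes "\<And>i. \<alpha> $ i > 0" "c > 0"
  shows "0 \<le> dirichlet_density \<alpha> c x"
  unfolding dirichlet_density_eq_gamma_power[OF assms]
  using assms by (intro mult_nonneg_nonneg prod_nonneg gamma_power_nonneg Gamma_real_nonneg
      add_nonneg_pos sum_nonneg) (auto intro: less_imp_le)

text \<open>
  Up to the factor \<open>\<Gamma>(\<Sum>\<alpha> + c)\<close> the integral is the convolution of all the power functions, evaluated at 1.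
\<close>

lemma dirichlet_density_has_integral_1:
  fixes \<alpha> :: "real ^ 'd"
  assumes "\<And>i. \<alpha> $ i > 0" "c > 0"
  shows "has_bochner_integral lborel (dirichlet_density \<alpha> c) 1"
proof -
  let ?G = "Gamma ((\<Sum>i\<in>UNIV. \<alpha> $ i) + c)"
  have G: "?G > 0"
    using assms by (intro Gamma_real_pos add_nonneg_pos sum_nonneg) (auto intro: less_imp_le)
  have "(\<integral>\<^sup>+x. ennreal (dirichlet_density \<alpha> c x) \<partial>lborel) = ennreal ?G * ennreal (gamma_power ((\<Sum>i\<in>UNIV. \<alpha> $ i) + c) 1)"
    unfolding dirichlet_density_eq_gamma_power[OF assms]
    using G assms by (simp add: ennreal_mult' nn_integral_cmult nn_integral_gamma_power_vec)
  also have "\<dots> = 1"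
    using G by (simp add: gamma_power_def ennreal_mult'[symmetric])
  finally show ?thesis
    using assms by (intro has_bochner_integral_nn_integral) (auto simp: dirichlet_density_nonneg dirichlet_density_measurable)
qed

section \<open>Asymptotics of quotients of Gamma functions\<close>

lemma Gamma_legendre_duplication_real:
  fixes z :: real
  assumes "z > 0"
  shows "Gamma z * Gamma (z + 1/2) = 2 powr (1 - 2 * z) * sqrt pi * Gamma (2 * z)"
proof -
  have "complex_of_real z \<notin> \<int>\<^sub>\<le>\<^sub>0" "complex_of_real z + 1/2 \<notin> \<int>\<^sub>\<le>\<^sub>0"
    using assms by (auto elim!: nonpos_Ints_cases' simp: complex_eq_iff)
  from Gamma_legendre_duplication[OF this]
  have "Gamma (complex_of_real z) * Gamma (complex_of_real (z + 1/2)) =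
      exp (complex_of_real ((1 - 2 * z) * ln 2)) * of_real (sqrt pi) * Gamma (complex_of_real (2 * z))"
    by simp
  then have "complex_of_real (Gamma z * Gamma (z + 1/2)) =
      complex_of_real (exp ((1 - 2 * z) * ln 2) * sqrt pi * Gamma (2 * z))"
    by (simp only: Gamma_complex_of_real exp_of_real of_real_mult[symmetric])
  then show ?thesis
    unfolding of_real_eq_iff by (simp add: powr_def)
qed

lemma Gamma_midpoint_le:
  fixes x y :: real
  assumes "x > 0" "y > 0"
  shows "Gamma ((x + y) / 2) ^ 2 \<le> Gamma x * Gamma y"
proof -
  have "(ln \<circ> Gamma) ((1 - 1/2) *\<^sub>R x + (1/2) *\<^sub>R y)
      \<le> (1 - 1/2) * (ln \<circ> Gamma) x + (1/2) * (ln \<circ> Gamma) y"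
    by (rule convex_onD[OF log_convex_Gamma_real]) (use assms in auto)
  then have "2 * ln (Gamma ((x + y) / 2)) \<le> ln (Gamma x) + ln (Gamma y)"
    by (simp add: field_simps)
  moreover have pos: "Gamma x > 0" "Gamma y > 0" "Gamma ((x + y) / 2) > 0"
    using assms by (auto intro!: Gamma_real_pos)
  ultimately have "ln (Gamma ((x + y) / 2) ^ 2) \<le> ln (Gamma x * Gamma y)"
    by (simp add: ln_mult ln_realpow)
  then show ?thesis
    using pos by simp
qed

lemma Gamma_plus1_pos: "z > 0 \<Longrightarrow> Gamma (z + 1) = z * Gamma (z :: real)"
  by (rule Gamma_plus1) auto

text \<open>
  Log-convexity bounds \<open>\<Gamma>\<close> at a midpoint by the geometric mean. The midpoints \<open>z + 1/2\<close> of \<open>z, z + 1\<close> and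
  \<open>z + 1\<close> of \<open>z + 1/2, z + 3/2\<close> give the two bounds, after the functional equation has been applied.
\<close>

lemma Gamma_half_shift_bounds:
  fixes z :: real
  assumes z: "z > 0"
  shows "z / sqrt (z + 1/2) \<le> Gamma (z + 1/2) / Gamma z"
    and "Gamma (z + 1/2) / Gamma z \<le> sqrt z"
proof -
  have G: "Gamma z > 0" "Gamma (z + 1/2) > 0"
    using z by auto
  have "Gamma (z + 1/2) ^ 2 \<le> z * Gamma z ^ 2"
    using Gamma_midpoint_le[of z "z + 1"] z Gamma_plus1_pos[of z]
    by (simp add: power2_eq_square field_simps)
  then have "(Gamma (z + 1/2) / Gamma z) ^ 2 \<le> z"
    using G by (simp add: power_divide field_simps)
  then show "Gamma (z + 1/2) / Gamma z \<le> sqrt z"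
    using real_le_rsqrt by blast
  have "Gamma (z + 1) ^ 2 \<le> (z + 1/2) * Gamma (z + 1/2) ^ 2"
  proof -
    have "(z + 1/2 + (z + 1/2 + 1)) / 2 = z + 1"
      by simp
    then show ?thesis
      using Gamma_midpoint_le[of "z + 1/2" "z + 1/2 + 1"] z Gamma_plus1_pos[of "z + 1/2"]
      by (simp only:) (simp add: power2_eq_square mult_ac)
  qed
  then have "(z * Gamma z) ^ 2 \<le> (z + 1/2) * Gamma (z + 1/2) ^ 2"
    using Gamma_plus1_pos[OF z] by simp
  moreover have "z + 1/2 > 0"
    using z by simp
  ultimately have "z\<^sup>2 / (z + 1/2) * (Gamma z)\<^sup>2 \<le> Gamma (z + 1/2) ^ 2"
    by (simp only: power_mult_distrib times_divide_eq_left pos_divide_le_eq mult.commute[of _ "z + 1/2"])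
  then have "z\<^sup>2 / (z + 1/2) \<le> (Gamma (z + 1/2) / Gamma z) ^ 2"
    using G(1) by (simp only: power_divide pos_le_divide_eq zero_less_power)
  then have "sqrt (z\<^sup>2 / (z + 1/2)) \<le> Gamma (z + 1/2) / Gamma z"
    using G by (intro real_le_lsqrt) auto
  then show "z / sqrt (z + 1/2) \<le> Gamma (z + 1/2) / Gamma z"
    using z by (simp add: real_sqrt_divide)
qed

lemma tendsto_Gamma_half_shift:
  "((\<lambda>z::real. Gamma (z + 1/2) / Gamma z / sqrt z) \<longlongrightarrow> 1) at_top"
proof (rule tendsto_sandwich)
  show "((\<lambda>z::real. z / sqrt (z + 1/2) / sqrt z) \<longlongrightarrow> 1) at_top"
    by real_asymp
  show "\<forall>\<^sub>F z::real in at_top. z / sqrt (z + 1/2) / sqrt z \<le> Gamma (z + 1/2) / Gamma z / sqrt z"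
    using eventually_gt_at_top[of 0]
    by eventually_elim (intro divide_right_mono Gamma_half_shift_bounds, auto)
  show "\<forall>\<^sub>F z::real in at_top. Gamma (z + 1/2) / Gamma z / sqrt z \<le> 1"
    using eventually_gt_at_top[of 0]
  proof eventually_elim
    case (elim z)
    then show ?case
      using divide_right_mono[OF Gamma_half_shift_bounds(2)[of z], of "sqrt z"] by simp
  qed
qed auto

text \<open>
  The growth of the central binomial coefficient \<open>binomial(2z, z)\<close> for real \<open>z\<close>. The duplication formula turns the
  quotient into \<open>\<Gamma>(z + 1/2) / \<Gamma>(z)\<close>.
\<close>

lemma tendsto_Gamma_double:
  "((\<lambda>z::real. Gamma (2 * z + 1) / Gamma (z + 1) ^ 2 * sqrt z / 4 powr z) \<longlongrightarrow> 1 / sqrt pi) at_top"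
proof -
  have "((\<lambda>z::real. (Gamma (z + 1/2) / Gamma z / sqrt z) / sqrt pi) \<longlongrightarrow> 1 / sqrt pi) at_top"
    by (intro tendsto_divide tendsto_Gamma_half_shift tendsto_const) auto
  moreover have "\<forall>\<^sub>F z::real in at_top. (Gamma (z + 1/2) / Gamma z / sqrt z) / sqrt pi =
      Gamma (2 * z + 1) / Gamma (z + 1) ^ 2 * sqrt z / 4 powr z"
    using eventually_gt_at_top[of 0]
  proof eventually_elim
    case (elim z)
    then have pos: "Gamma z > 0" "Gamma (z + 1/2) > 0" "Gamma (2 * z) > 0" "sqrt z > 0" by auto
    have p: "(2::real) powr (1 - 2 * z) = 2 / 4 powr z"
      by (simp add: powr_diff powr_powr[symmetric])
    have "Gamma (2 * z) = Gamma z * Gamma (z + 1/2) * 4 powr z / (2 * sqrt pi)"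
      using Gamma_legendre_duplication_real[OF elim] unfolding p by (simp add: field_simps)
    then have "Gamma (2 * z + 1) / Gamma (z + 1) ^ 2 * sqrt z / 4 powr z
        = Gamma (z + 1/2) / Gamma z * (sqrt z / z) / sqrt pi"
      using pos elim Gamma_plus1_pos[of z] Gamma_plus1_pos[of "2 * z"]
      by (simp add: divide_simps power2_eq_square mult_ac)
    also have "sqrt z / z = 1 / sqrt z"
      using elim by (simp add: real_div_sqrt field_simps)
    finally show ?case
      by simp
  qed
  ultimately show ?thesis
    by (rule Lim_transform_eventually)
qed

lemma tendsto_Gamma_nat_shift:
  "((\<lambda>z::real. Gamma (z + 1 + real d) / Gamma (z + 1) / z ^ d) \<longlongrightarrow> 1) at_top"
proof (induction d)
  case 0
  have "((\<lambda>z::real. 1) \<longlongrightarrow> 1) at_top" by simp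
  then show ?case
    by (rule Lim_transform_eventually) (use eventually_gt_at_top[of 0] in \<open>eventually_elim; simp add: less_imp_neq[OF Gamma_real_pos, symmetric]\<close>)
next
  case (Suc d)
  have "((\<lambda>z::real. (z + 1 + real d) / z) \<longlongrightarrow> 1) at_top"
    by real_asymp
  from tendsto_mult[OF this Suc]
  have "((\<lambda>z::real. (z + 1 + real d) / z * (Gamma (z + 1 + real d) / Gamma (z + 1) / z ^ d)) \<longlongrightarrow> 1) at_top"
    by simp
  then show ?case
  proof (rule Lim_transform_eventually)
    show "\<forall>\<^sub>F z::real in at_top. (z + 1 + real d) / z * (Gamma (z + 1 + real d) / Gamma (z + 1) / z ^ d)
       = Gamma (z + 1 + real (Suc d)) / Gamma (z + 1) / z ^ Suc d"
      using eventually_gt_at_top[of 0]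
    proof eventually_elim
      case (elim z)
      then show ?case
        using Gamma_plus1_pos[of "z + 1 + real d"] by (simp add: add_ac)
    qed
  qed
qed

section \<open>Powers of the Dirichlet kernel\<close>

definition dirichlet_kernel :: "real ^ 'd \<Rightarrow> real \<Rightarrow> real ^ 'd \<Rightarrow> real" where
  "dirichlet_kernel s b = dirichlet_density (\<chi> j. s $ j / b + 1) ((1 - l1_norm s) / b + 1)"

text \<open>
  The argument of the Gamma function in the numerator is the sum of the parameters \<open>s\<^sub>i / b + 1\<close> and
  \<open>(1 - \<parallel>s\<parallel>) / b + 1\<close>.
\<close>

definition kernel_const :: "real ^ 'd \<Rightarrow> real \<Rightarrow> real" where
  "kernel_const s b = Gamma (1 / b + 1 + real CARD('d)) /
     (Gamma ((1 - l1_norm s) / b + 1) * (\<Prod>i\<in>UNIV. Gamma (s $ i / b + 1)))"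

text \<open>
  The factor in \<open>K\<^sub>b\<^sup>2 = A\<^sub>b K\<^sub>b\<^sub>/\<^sub>2\<close>. As \<open>K\<^sub>b\<^sub>/\<^sub>2\<close> is a probability density, it is also the integral of \<open>K\<^sub>b\<^sup>2\<close>.
\<close>

definition kernel_energy :: "real ^ 'd \<Rightarrow> real \<Rightarrow> real" where
  "kernel_energy s b = kernel_const s b ^ 2 / kernel_const s (b / 2)"

lemma simplex_intD:
  assumes "s \<in> simplex_int"
  shows "s $ i > 0" "l1_norm s < 1" "l1_norm s = (\<Sum>i\<in>UNIV. s $ i)"
  using assms by (auto simp: simplex_int_def l1_norm_nonneg_vec less_imp_le)

lemma kernel_const_pos: "s \<in> simplex_int \<Longrightarrow> b > 0 \<Longrightarrow> kernel_const s b > 0"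
  unfolding kernel_const_def
  by (intro divide_pos_pos mult_pos_pos prod_pos Gamma_real_pos add_nonneg_pos)
     (auto dest: simplex_intD(2) intro!: divide_nonneg_pos add_nonneg_pos simplex_intD(1)[THEN less_imp_le])

lemma dirichlet_kernel_params:
  assumes "s \<in> simplex_int" "b > 0"
  shows "\<And>i. (\<chi> j. s $ j / b + 1) $ i > 0" "(1 - l1_norm s) / b + 1 > 0"
  using simplex_intD[OF assms(1)] assms(2) by (auto intro!: add_pos_pos)

lemma sum_dirichlet_kernel_params:
  fixes s :: "real ^ 'd"
  assumes "s \<in> simplex_int" "b > 0"
  shows "(\<Sum>i\<in>UNIV. (\<chi> j. s $ j / b + 1) $ i) + ((1 - l1_norm s) / b + 1) = 1 / b + 1 + real CARD('d)"
  using simplex_intD(3)[OF assms(1)] assms(2)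
  by (simp add: sum.distrib sum_divide_distrib[symmetric] diff_divide_distrib)

lemma dirichlet_kernel_eq:
  fixes s :: "real ^ 'd"
  assumes "s \<in> simplex_int" "b > 0" "x \<in> simplex_set"
  shows "dirichlet_kernel s b x =
     kernel_const s b * ((1 - l1_norm x) powr ((1 - l1_norm s) / b) * (\<Prod>i\<in>UNIV. x $ i powr (s $ i / b)))"
proof -
  have "l1_norm (\<chi> j. s $ j / b + 1) = (\<Sum>i\<in>UNIV. (\<chi> j. s $ j / b + 1) $ i)"
    using dirichlet_kernel_params[OF assms(1,2)] by (intro l1_norm_nonneg_vec) (auto simp: less_imp_le)
  then show ?thesis
    unfolding dirichlet_kernel_def dirichlet_density_def kernel_const_def
      sum_dirichlet_kernel_params[OF assms(1,2), symmetric]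
    using assms(3) by simp
qed

lemma dirichlet_kernel_eq_0: "x \<notin> simplex_set \<Longrightarrow> dirichlet_kernel s b x = 0"
  by (simp add: dirichlet_kernel_def dirichlet_density_def)

text \<open>
  Squaring doubles the exponents \<open>s\<^sub>i / b\<close>, which is the same as halving the bandwidth.
\<close>

lemma dirichlet_kernel_power2:
  assumes "s \<in> simplex_int" "b > 0"
  shows "dirichlet_kernel s b x ^ 2 = kernel_energy s b * dirichlet_kernel s (b / 2) x"
proof (cases "x \<in> simplex_set")
  case True
  have nn: "0 \<le> x $ i" "0 \<le> 1 - l1_norm x" for i
    using True by (auto simp: simplex_set_def)
  have sq: "(y powr (a / b)) ^ 2 = y powr (a / (b / 2))" for y a :: real
    by (simp add: power2_eq_square powr_add[symmetric] add_divide_distrib[symmetric] mult.commute)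
  show ?thesis
    using kernel_const_pos[of s "b / 2"] assms
    unfolding dirichlet_kernel_eq[OF assms True] dirichlet_kernel_eq[OF assms(1) half_gt_zero[OF assms(2)] True]
    by (simp add: kernel_energy_def power_mult_distrib sq prod_power_distrib)
qed (simp add: dirichlet_kernel_eq_0)

lemma sqrt_prod: "sqrt (\<Prod>i\<in>I. f i) = (\<Prod>i\<in>I. sqrt (f i))"
  by (induction I rule: infinite_finite_induct) (simp_all add: real_sqrt_mult)

text \<open>
  With \<open>N = 1 / b\<close> the quotient consists of \<open>\<Gamma>(N + d + 1)\<^sup>2 / \<Gamma>(2N + d + 1)\<close> and one factor
  \<open>\<Gamma>(2z + 1) / \<Gamma>(z + 1)\<^sup>2\<close> for every barycentric coordinate of \<open>s\<close>, where \<open>z\<close> is \<open>N\<close> times that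
  coordinate. Below, \<open>T\<close> and \<open>P\<close> are these quotients divided by their growth rates, so that both converge;
  in the identity \<open>id\<close> the powers of 4 and of \<open>N\<close> cancel and only convergent factors remain.
\<close>

lemma kernel_energy_asymptotics:
  fixes s :: "real ^ 'd"
  assumes s: "s \<in> simplex_int"
  shows "((\<lambda>b. b powr (real CARD('d) / 2) * kernel_energy s b) \<longlongrightarrow> psi s) (at_right 0)"
proof -
  let ?d = "CARD('d)"
  define s0 where "s0 = 1 - l1_norm s"
  have s_pos: "s $ i > 0" "s0 > 0" for i
    using simplex_intD[OF s] by (auto simp: s0_def)
  have s_sum: "s0 + (\<Sum>i\<in>UNIV. s $ i) = 1"
    using simplex_intD(3)[OF s] by (simp add: s0_def)
  define T where "T z = Gamma (2 * z + 1) / Gamma (z + 1) ^ 2 * sqrt z / 4 powr z" for z :: real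
  define P where "P z = Gamma (z + 1 + real ?d) / Gamma (z + 1) / z ^ ?d" for z :: real
  define Q where "Q = (\<Prod>i\<in>UNIV. s $ i)"
  have Q: "Q > 0"
    unfolding Q_def using s_pos by (intro prod_pos) auto
  have ratio: "Gamma (2 * z + 1) / Gamma (z + 1) ^ 2 = T z * 4 powr z / sqrt z" if "z > 0" for z
    using that by (simp add: T_def)
  have T_pos: "T z > 0" if "z > 0" for z
    unfolding T_def using that by (auto intro!: divide_pos_pos mult_pos_pos Gamma_real_pos zero_less_power)
  have P_pos: "P z > 0" if "z > 0" for z
    unfolding P_def using that by (auto intro!: divide_pos_pos mult_pos_pos Gamma_real_pos zero_less_power)
  define F where "F N = P N ^ 2 / P (2 * N) / 2 ^ ?d / T N * (T (s0 * N) * (\<Prod>i\<in>UNIV. T (s $ i * N))) / sqrt (s0 * Q)" for N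
  have id: "b powr (real ?d / 2) * kernel_energy s b = F (inverse b)" if b: "b > 0" for b
  proof -
    define N where "N = inverse b"
    have N: "N > 0" using b by (simp add: N_def)
    \<comment> \<open>Integer powers of \<open>w\<close> replace the half-integer powers of \<open>N\<close>.\<close>
    define w where "w = sqrt N"
    have w: "w > 0" "w ^ 2 = N" using N by (auto simp: w_def)
    let ?G = "Gamma (N + 1 + real ?d)" and ?H = "Gamma (2 * N + 1 + real ?d)"
    have G: "?G > 0" "?H > 0" "Gamma (N + 1) > 0" "Gamma (2 * N + 1) > 0"
      using N by (auto intro!: Gamma_real_pos)
    note nz = G[THEN less_imp_neq, symmetric]
    have "b = inverse N" by (simp add: N_def)
    then have k1: "kernel_const s b = ?G / (Gamma (s0 * N + 1) * (\<Prod>i\<in>UNIV. Gamma (s $ i * N + 1)))"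
      and k2: "kernel_const s (b / 2) = ?H / (Gamma (2 * (s0 * N) + 1) * (\<Prod>i\<in>UNIV. Gamma (2 * (s $ i * N) + 1)))"
      unfolding kernel_const_def s0_def[symmetric] by (simp_all add: field_simps)
    have bw: "b powr (real ?d / 2) = 1 / w ^ ?d"
    proof -
      have "b powr (real ?d / 2) = (b powr (1/2)) powr real ?d"
        by (simp add: powr_powr)
      also have "\<dots> = sqrt b ^ ?d"
        using b by (simp add: powr_half_sqrt powr_realpow)
      finally show ?thesis
        by (simp add: w_def N_def real_sqrt_divide power_one_over inverse_eq_divide)
    qed
    have "kernel_const s b ^ 2 / kernel_const s (b / 2)
        = ?G ^ 2 / ?H * ((Gamma (2 * (s0 * N) + 1) / Gamma (s0 * N + 1) ^ 2)
           * (\<Prod>i\<in>UNIV. Gamma (2 * (s $ i * N) + 1) / Gamma (s $ i * N + 1) ^ 2))"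
      unfolding k1 k2 prod_dividef prod_power_distrib[symmetric] by (simp add: power_divide power_mult_distrib mult_ac)
    also have "(Gamma (2 * (s0 * N) + 1) / Gamma (s0 * N + 1) ^ 2) = T (s0 * N) * 4 powr (s0 * N) / sqrt (s0 * N)"
      using s_pos N by (intro ratio) auto
    also have "(\<Prod>i\<in>UNIV. Gamma (2 * (s $ i * N) + 1) / Gamma (s $ i * N + 1) ^ 2)
        = (\<Prod>i\<in>UNIV. T (s $ i * N) * 4 powr (s $ i * N) / sqrt (s $ i * N))"
      using s_pos N by (intro prod.cong ratio) auto
    also have "\<dots> = (\<Prod>i\<in>UNIV. T (s $ i * N)) * 4 powr (\<Sum>i\<in>UNIV. s $ i * N) / (sqrt Q * w ^ ?d)"
      unfolding Q_def w_def by (simp add: prod_dividef prod.distrib powr_sum real_sqrt_mult sqrt_prod)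
    also have "?G ^ 2 / ?H = P N ^ 2 / P (2 * N) * (w ^ (2 * ?d) / 2 ^ ?d) * (w / (T N * 4 powr N))"
    proof -
      have "?G = P N * Gamma (N + 1) * N ^ ?d"
        using N by (simp add: P_def nz)
      moreover have "?H = P (2 * N) * Gamma (2 * N + 1) * (2 * N) ^ ?d"
        using N by (simp add: P_def nz)
      moreover have "Gamma (2 * N + 1) = T N * 4 powr N / w * Gamma (N + 1) ^ 2"
        unfolding w_def ratio[OF N, symmetric] by (simp add: nz)
      moreover have "w ^ (2 * ?d) = N ^ ?d"
        by (simp add: power_mult w(2))
      moreover have "P (2 * N) > 0" "T N > 0"
        using N T_pos P_pos by auto
      ultimately show ?thesis
        using N w(1) by (simp add: power_mult_distrib power2_eq_square nz mult_ac)
    qed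
    finally have kc: "kernel_const s b ^ 2 / kernel_const s (b / 2) =
      P N ^ 2 / P (2 * N) * (w ^ (2 * ?d) / 2 ^ ?d) * (w / (T N * 4 powr N)) *
       (T (s0 * N) * 4 powr (s0 * N) / sqrt (s0 * N) *
        ((\<Prod>i\<in>UNIV. T (s $ i * N)) * 4 powr (\<Sum>i\<in>UNIV. s $ i * N) / (sqrt Q * w ^ ?d)))" .
    \<comment> \<open>The coordinates of \<open>s\<close> sum to 1, so the exponential factors cancel.\<close>
    have "4 powr (s0 * N) * 4 powr (\<Sum>i\<in>UNIV. s $ i * N) = 4 powr N"
      unfolding powr_add[symmetric] sum_distrib_right[symmetric] distrib_right[symmetric] s_sum by simp
    then have pw: "4 powr (\<Sum>i\<in>UNIV. s $ i * N) = 4 powr N / 4 powr (s0 * N)"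
      by (simp add: field_simps)
    have sq: "sqrt (s0 * N) = sqrt s0 * w" "sqrt (s0 * Q) = sqrt s0 * sqrt Q" "w ^ (2 * ?d) = w ^ ?d * w ^ ?d"
      by (simp_all add: w_def real_sqrt_mult mult_2 power_add)
    show ?thesis
      unfolding kernel_energy_def bw kc F_def N_def[symmetric] pw sq using w(1) by simp
  qed
  have scale: "filterlim (\<lambda>b::real. a * inverse b) at_top (at_right 0)" if "a > 0" for a
    by (rule filterlim_tendsto_pos_mult_at_top[OF tendsto_const that filterlim_inverse_at_top_right])
  have Tl: "((\<lambda>b::real. T (a * inverse b)) \<longlongrightarrow> 1 / sqrt pi) (at_right 0)" if "a > 0" for a
    unfolding T_def by (rule filterlim_compose[OF tendsto_Gamma_double scale[OF that]])
  have Pl: "((\<lambda>b::real. P (a * inverse b)) \<longlongrightarrow> 1) (at_right 0)" if "a > 0" for a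
    unfolding P_def by (rule filterlim_compose[OF tendsto_Gamma_nat_shift scale[OF that]])
  have "((\<lambda>b. F (inverse b)) \<longlongrightarrow> 1 ^ 2 / 1 / 2 ^ ?d / (1 / sqrt pi) * (1 / sqrt pi * (\<Prod>i\<in>(UNIV :: 'd set). 1 / sqrt pi)) / sqrt (s0 * Q)) (at_right 0)"
    unfolding F_def
    by (intro tendsto_intros Tl s_pos Tl[of 1, simplified] Pl[of 1, simplified] Pl) (use s_pos(2) Q in auto)
  also have "1 ^ 2 / 1 / 2 ^ ?d / (1 / sqrt pi) * (1 / sqrt pi * (\<Prod>i\<in>(UNIV :: 'd set). 1 / sqrt pi)) / sqrt (s0 * Q)
      = psi s"
  proof -
    have "psi s = 1 / sqrt ((4 * pi) ^ ?d * (s0 * Q))"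
      unfolding psi_def s0_def[symmetric] Q_def[symmetric] using s_pos Q
      by (simp add: powr_minus powr_half_sqrt mult.assoc inverse_eq_divide)
    also have "sqrt ((4 * pi) ^ ?d * (s0 * Q)) = 2 ^ ?d * sqrt pi ^ ?d * sqrt (s0 * Q)"
      by (simp add: real_sqrt_mult real_sqrt_power power_mult_distrib)
    finally show ?thesis
      by (simp add: power_one_over)
  qed
  finally show ?thesis
    by (rule Lim_transform_eventually) (use id in \<open>auto simp: eventually_at_filter\<close>)
qed

section \<open>Moments of the Dirichlet distribution\<close>

lemma bounded_mult_dirichlet_density_integrable:
  fixes \<alpha> :: "real ^ 'd"
  assumes "\<And>i. \<alpha> $ i > 0" "c > 0" and [measurable]: "g \<in> borel_measurable borel"
    and B: "\<And>x. x \<in> simplex_set \<Longrightarrow> \<bar>g x\<bar> \<le> B"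
  shows "integrable lborel (\<lambda>x. g x * dirichlet_density \<alpha> c x)"
proof (rule Bochner_Integration.integrable_bound)
  note [measurable] = dirichlet_density_measurable[OF assms(1,2)]
  show "integrable lborel (\<lambda>x. B * dirichlet_density \<alpha> c x)"
    using dirichlet_density_has_integral_1[OF assms(1,2)]
    by (intro integrable_mult_right) (auto simp: has_bochner_integral_iff)
  show "(\<lambda>x. g x * dirichlet_density \<alpha> c x) \<in> borel_measurable lborel"
    by measurable
  show "AE x in lborel. norm (g x * dirichlet_density \<alpha> c x) \<le> norm (B * dirichlet_density \<alpha> c x)"
  proof (rule AE_I2)
    fix x show "norm (g x * dirichlet_density \<alpha> c x) \<le> norm (B * dirichlet_density \<alpha> c x)"
    proof (cases "x \<in> simplex_set")
      case True
      then have "norm (g x) \<le> norm B"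
        using B[of x] by simp
      then show ?thesis
        by (simp add: abs_mult mult_right_mono)
    qed (simp add: dirichlet_density_def)
  qed
qed

text \<open>
  Multiplication by a coordinate raises one exponent by 1. The two normalising constants differ by the
  factor \<open>\<alpha>\<^sub>i / (\<Sum>\<alpha> + c)\<close>, by the functional equation of \<open>\<Gamma>\<close>. This is a pointwise identity, also for points
  outside the simplex and on its boundary.
\<close>

lemma coordinate_mult_dirichlet_density:
  fixes \<alpha> :: "real ^ 'd"
  assumes "\<And>i. \<alpha> $ i > 0" "c > 0"
  shows "x $ i * dirichlet_density \<alpha> c x =
     \<alpha> $ i / ((\<Sum>j\<in>UNIV. \<alpha> $ j) + c) * dirichlet_density (\<alpha> + axis i 1) c x"
proof -
  let ?A = "(\<Sum>j\<in>UNIV. \<alpha> $ j) + c" and ?\<alpha> = "\<alpha> + axis i 1"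
  have A: "?A > 0"
    using assms by (intro add_nonneg_pos sum_nonneg) (auto intro: less_imp_le)
  have pos': "?\<alpha> $ j > 0" for j
    using assms(1)[of j] by (auto simp: axis_def intro: add_pos_pos)
  have step: "y * gamma_power a y = a * gamma_power (a + 1) y" if "a > 0" for a y
  proof (cases "y > 0")
    case True
    then have "y * y powr (a - 1) = y powr a"
      using powr_add[of y 1 "a - 1"] by simp
    moreover have "Gamma a > 0"
      using that by simp
    ultimately show ?thesis
      using True that by (simp add: gamma_power_def Gamma_plus1_pos)
  qed (auto simp: gamma_power_def indicator_def)
  have sum': "(\<Sum>j\<in>UNIV. ?\<alpha> $ j) + c = ?A + 1"
    by (simp add: sum.distrib axis_def)
  have "(\<Prod>j\<in>UNIV. gamma_power (?\<alpha> $ j) (x $ j))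
      = gamma_power (\<alpha> $ i + 1) (x $ i) * (\<Prod>j\<in>UNIV - {i}. gamma_power (\<alpha> $ j) (x $ j))"
    by (subst prod.remove[of _ i]) (auto simp: axis_def intro!: prod.cong)
  moreover have "(\<Prod>j\<in>UNIV. gamma_power (\<alpha> $ j) (x $ j))
      = gamma_power (\<alpha> $ i) (x $ i) * (\<Prod>j\<in>UNIV - {i}. gamma_power (\<alpha> $ j) (x $ j))"
    by (subst prod.remove[of _ i]) auto
  ultimately have "x $ i * (\<Prod>j\<in>UNIV. gamma_power (\<alpha> $ j) (x $ j))
      = \<alpha> $ i * (\<Prod>j\<in>UNIV. gamma_power (?\<alpha> $ j) (x $ j))"
    using step[OF assms(1)[of i], of "x $ i"] by simp
  then show ?thesis
    unfolding dirichlet_density_eq_gamma_power[OF assms] dirichlet_density_eq_gamma_power[OF pos' assms(2)]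
      sum' Gamma_plus1_pos[OF A] using A by simp
qed

lemma dirichlet_moment_step:
  fixes \<alpha> :: "real ^ 'd"
  assumes "\<And>i. \<alpha> $ i > 0" "c > 0"
  shows "(\<integral>x. x $ i * g x * dirichlet_density \<alpha> c x \<partial>lborel) =
     \<alpha> $ i / ((\<Sum>j\<in>UNIV. \<alpha> $ j) + c) * (\<integral>x. g x * dirichlet_density (\<alpha> + axis i 1) c x \<partial>lborel)"
proof -
  have "x $ i * g x * dirichlet_density \<alpha> c x
     = \<alpha> $ i / ((\<Sum>j\<in>UNIV. \<alpha> $ j) + c) * (g x * dirichlet_density (\<alpha> + axis i 1) c x)" for x
    using coordinate_mult_dirichlet_density[OF assms, of x i] by (simp add: mult_ac)
  then show ?thesis
    by simp
qed

lemma dirichlet_moments: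
  fixes \<alpha> :: "real ^ 'd"
  assumes pos: "\<And>i. \<alpha> $ i > 0" "c > 0" and A: "A = (\<Sum>j\<in>UNIV. \<alpha> $ j) + c"
  shows "(\<integral>x. dirichlet_density \<alpha> c x \<partial>lborel) = 1"
    and "(\<integral>x. x $ i * dirichlet_density \<alpha> c x \<partial>lborel) = \<alpha> $ i / A"
    and "(\<integral>x. x $ i * x $ j * dirichlet_density \<alpha> c x \<partial>lborel) =
           \<alpha> $ i * (\<alpha> $ j + of_bool (i = j)) / (A * (A + 1))"
    and "(\<integral>x. x $ i ^ 3 * dirichlet_density \<alpha> c x \<partial>lborel) =
           \<alpha> $ i * (\<alpha> $ i + 1) * (\<alpha> $ i + 2) / (A * (A + 1) * (A + 2))"
    and "(\<integral>x. x $ i ^ 4 * dirichlet_density \<alpha> c x \<partial>lborel) =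
           \<alpha> $ i * (\<alpha> $ i + 1) * (\<alpha> $ i + 2) * (\<alpha> $ i + 3) / (A * (A + 1) * (A + 2) * (A + 3))"
proof -
  have m0: "(\<integral>x. dirichlet_density \<alpha> c x \<partial>lborel) = 1" if "\<And>i. \<alpha> $ i > 0" for \<alpha> :: "real ^ 'd"
    using dirichlet_density_has_integral_1[OF that pos(2)] by (simp add: has_bochner_integral_iff)
  have pos': "(\<alpha> + axis i 1) $ k > 0" if "\<And>i. \<alpha> $ i > 0" for \<alpha> :: "real ^ 'd" and i k
    using that[of k] by (auto simp: axis_def intro: add_pos_pos)
  have sum': "(\<Sum>j\<in>UNIV. (\<alpha> + axis i 1) $ j) + c = (\<Sum>j\<in>UNIV. \<alpha> $ j) + c + 1" for \<alpha> :: "real ^ 'd" and i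
    by (simp add: sum.distrib axis_def)
  have comp': "(\<alpha> + axis i 1) $ j = \<alpha> $ j + of_bool (i = j)" for \<alpha> :: "real ^ 'd" and i j
    by (simp add: axis_def)
  have m1: "(\<integral>x. x $ i * dirichlet_density \<alpha> c x \<partial>lborel) = \<alpha> $ i / ((\<Sum>j\<in>UNIV. \<alpha> $ j) + c)"
    if "\<And>i. \<alpha> $ i > 0" for \<alpha> :: "real ^ 'd" and i
    using dirichlet_moment_step[OF that pos(2), of i "\<lambda>_. 1"] m0[OF pos'[OF that]] by simp
  have m2: "(\<integral>x. x $ i * x $ j * dirichlet_density \<alpha> c x \<partial>lborel) = \<alpha> $ i / ((\<Sum>j\<in>UNIV. \<alpha> $ j) + c)
      * ((\<alpha> $ j + of_bool (i = j)) / ((\<Sum>j\<in>UNIV. \<alpha> $ j) + c + 1))"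
    if "\<And>i. \<alpha> $ i > 0" for \<alpha> :: "real ^ 'd" and i j
    unfolding dirichlet_moment_step[OF that pos(2), of i "\<lambda>x. x $ j"] m1[OF pos'[OF that]] sum' comp' ..
  have m3: "(\<integral>x. x $ i ^ 3 * dirichlet_density \<alpha> c x \<partial>lborel) = \<alpha> $ i / ((\<Sum>j\<in>UNIV. \<alpha> $ j) + c)
      * ((\<alpha> $ i + 1) / ((\<Sum>j\<in>UNIV. \<alpha> $ j) + c + 1) * ((\<alpha> $ i + 2) / ((\<Sum>j\<in>UNIV. \<alpha> $ j) + c + 2)))"
    if "\<And>i. \<alpha> $ i > 0" for \<alpha> :: "real ^ 'd" and i
  proof -
    have "(\<integral>x. x $ i ^ 3 * dirichlet_density \<alpha> c x \<partial>lborel) = (\<integral>x. x $ i * (x $ i * x $ i) * dirichlet_density \<alpha> c x \<partial>lborel)"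
      by (simp add: power3_eq_cube mult_ac)
    then show ?thesis
      unfolding dirichlet_moment_step[OF that pos(2), of i "\<lambda>x. x $ i * x $ i"] m2[OF pos'[OF that]] sum' comp'
      by (simp add: add_ac)
  qed
  have m4: "(\<integral>x. x $ i ^ 4 * dirichlet_density \<alpha> c x \<partial>lborel) = \<alpha> $ i / ((\<Sum>j\<in>UNIV. \<alpha> $ j) + c)
      * ((\<alpha> $ i + 1) / ((\<Sum>j\<in>UNIV. \<alpha> $ j) + c + 1) * ((\<alpha> $ i + 2) / ((\<Sum>j\<in>UNIV. \<alpha> $ j) + c + 2)
      * ((\<alpha> $ i + 3) / ((\<Sum>j\<in>UNIV. \<alpha> $ j) + c + 3))))"
    if "\<And>i. \<alpha> $ i > 0" for \<alpha> :: "real ^ 'd" and i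
  proof -
    have "(\<integral>x. x $ i ^ 4 * dirichlet_density \<alpha> c x \<partial>lborel) = (\<integral>x. x $ i * x $ i ^ 3 * dirichlet_density \<alpha> c x \<partial>lborel)"
      by (simp add: power3_eq_cube power4_eq_xxxx mult_ac)
    then show ?thesis
      unfolding dirichlet_moment_step[OF that pos(2), of i "\<lambda>x. x $ i ^ 3"] m3[OF pos'[OF that]] sum' comp'
      by (simp add: add_ac)
  qed
  show "(\<integral>x. dirichlet_density \<alpha> c x \<partial>lborel) = 1"
    and "(\<integral>x. x $ i * dirichlet_density \<alpha> c x \<partial>lborel) = \<alpha> $ i / A"
    and "(\<integral>x. x $ i * x $ j * dirichlet_density \<alpha> c x \<partial>lborel) =
           \<alpha> $ i * (\<alpha> $ j + of_bool (i = j)) / (A * (A + 1))"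
    and "(\<integral>x. x $ i ^ 3 * dirichlet_density \<alpha> c x \<partial>lborel) =
           \<alpha> $ i * (\<alpha> $ i + 1) * (\<alpha> $ i + 2) / (A * (A + 1) * (A + 2))"
    and "(\<integral>x. x $ i ^ 4 * dirichlet_density \<alpha> c x \<partial>lborel) =
           \<alpha> $ i * (\<alpha> $ i + 1) * (\<alpha> $ i + 2) * (\<alpha> $ i + 3) / (A * (A + 1) * (A + 2) * (A + 3))"
    unfolding A m0[OF pos(1)] m1[OF pos(1)] m2[OF pos(1)] m3[OF pos(1)] m4[OF pos(1)]
    by (simp_all add: mult_ac)
qed

section \<open>Means with respect to the kernel\<close>

text \<open>
  The kernel vanishes outside the simplex, so boundedness on the simplex is what makes a measurable function integrable against
  it. Polynomials are unbounded on the whole space but belong to this class.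
\<close>

definition simplex_bounded :: "(real ^ 'd \<Rightarrow> real) \<Rightarrow> bool" where
  "simplex_bounded g \<longleftrightarrow> g \<in> borel_measurable borel \<and> (\<exists>B. \<forall>x\<in>simplex_set. \<bar>g x\<bar> \<le> B)"

definition kernel_mean :: "real ^ 'd \<Rightarrow> real \<Rightarrow> (real ^ 'd \<Rightarrow> real) \<Rightarrow> real" where
  "kernel_mean s b g = (\<integral>x. g x * dirichlet_kernel s b x \<partial>lborel)"

lemma compact_simplex_set: "compact (simplex_set :: (real ^ 'd) set)"
  unfolding compact_eq_bounded_closed
proof
  show "bounded (simplex_set :: (real ^ 'd) set)"
    unfolding bounded_iff
  proof (intro exI ballI)
    fix x :: "real ^ 'd" assume "x \<in> simplex_set"
    then have "norm x \<le> l1_norm x" "l1_norm x \<le> 1"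
      using norm_le_l1_cart[of x] by (auto simp: simplex_set_def l1_norm_def)
    then show "norm x \<le> 1" by simp
  qed
  have eq: "simplex_set = {x :: real ^ 'd. (\<Sum>i\<in>UNIV. x $ i) \<le> 1} \<inter> (\<Inter>i. {x. 0 \<le> x $ i})"
    by (auto simp: simplex_set_iff)
  show "closed (simplex_set :: (real ^ 'd) set)"
    unfolding eq
    by (intro closed_Int closed_INT ballI closed_Collect_le continuous_intros)
qed

lemma simplex_int_subset_interior: "s \<in> simplex_int \<Longrightarrow> s \<in> interior simplex_set"
proof (rule interiorI)
  have eq: "simplex_int = {x :: real ^ 'd. (\<Sum>i\<in>UNIV. \<bar>x $ i\<bar>) < 1} \<inter> (\<Inter>i. {x. 0 < x $ i} \<inter> {x. x $ i < 1})"
    by (auto simp: simplex_int_def l1_norm_def)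
  show "open (simplex_int :: (real ^ 'd) set)"
    unfolding eq
    by (intro open_Int open_INT ballI open_Collect_less continuous_intros) auto
  show "simplex_int \<subseteq> (simplex_set :: (real ^ 'd) set)"
    by (force simp: simplex_int_def simplex_set_def less_imp_le)
qed

lemma simplex_bounded_continuous: "continuous_on UNIV g \<Longrightarrow> simplex_bounded g"
proof -
  assume g: "continuous_on UNIV g"
  then have "bounded (g ` simplex_set)"
    by (intro compact_imp_bounded compact_continuous_image compact_simplex_set) (auto intro: continuous_on_subset)
  then show ?thesis
    using g by (auto simp: simplex_bounded_def bounded_iff intro: borel_measurable_continuous_onI)
qed

text \<open>
  Continuity on the simplex does not imply global continuity here: a density may jump to 0 at the
  boundary. Measurability is therefore a separate assumption.
\<close>

lemma simplex_bounded_on: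
  "continuous_on simplex_set g \<Longrightarrow> g \<in> borel_measurable borel \<Longrightarrow> simplex_bounded g"
  using compact_imp_bounded[OF compact_continuous_image[OF _ compact_simplex_set], of g]
  by (auto simp: simplex_bounded_def bounded_iff)

lemma simplex_bounded_add:
  assumes "simplex_bounded g" "simplex_bounded h" shows "simplex_bounded (\<lambda>x. g x + h x)"
proof -
  from assms obtain B C where "\<forall>x\<in>simplex_set. \<bar>g x\<bar> \<le> B" "\<forall>x\<in>simplex_set. \<bar>h x\<bar> \<le> C"
    and [measurable]: "g \<in> borel_measurable borel" "h \<in> borel_measurable borel"
    by (auto simp: simplex_bounded_def)
  then have "\<forall>x\<in>simplex_set. \<bar>g x + h x\<bar> \<le> B + C"
    by (fastforce intro: order_trans[OF abs_triangle_ineq] add_mono)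
  then show ?thesis
    by (auto simp: simplex_bounded_def)
qed

lemma simplex_bounded_cmult:
  assumes "simplex_bounded g" shows "simplex_bounded (\<lambda>x. c * g x)"
proof -
  from assms obtain B where "\<forall>x\<in>simplex_set. \<bar>g x\<bar> \<le> B"
    and [measurable]: "g \<in> borel_measurable borel"
    by (auto simp: simplex_bounded_def)
  then have "\<forall>x\<in>simplex_set. \<bar>c * g x\<bar> \<le> \<bar>c\<bar> * B"
    by (auto simp: abs_mult intro: mult_left_mono)
  then show ?thesis
    by (auto simp: simplex_bounded_def)
qed

lemma simplex_bounded_diff:
  assumes "simplex_bounded g" "simplex_bounded h" shows "simplex_bounded (\<lambda>x. g x - h x)"
  using simplex_bounded_add[OF assms(1) simplex_bounded_cmult[OF assms(2), of "- 1"]] by simp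

lemma dirichlet_kernel_measurable:
  "s \<in> simplex_int \<Longrightarrow> b > 0 \<Longrightarrow> dirichlet_kernel s b \<in> borel_measurable borel"
  unfolding dirichlet_kernel_def by (intro dirichlet_density_measurable dirichlet_kernel_params)

lemma dirichlet_kernel_nonneg:
  "s \<in> simplex_int \<Longrightarrow> b > 0 \<Longrightarrow> 0 \<le> dirichlet_kernel s b x"
  unfolding dirichlet_kernel_def by (intro dirichlet_density_nonneg dirichlet_kernel_params)

lemma kernel_mean_integrable:
  assumes "s \<in> simplex_int" "b > 0" "simplex_bounded g"
  shows "integrable lborel (\<lambda>x. g x * dirichlet_kernel s b x)"
  using assms(3) unfolding simplex_bounded_def dirichlet_kernel_def
  by (auto intro!: bounded_mult_dirichlet_density_integrable dirichlet_kernel_params[OF assms(1,2)] simp del: vec_lambda_beta)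

lemma kernel_mean_add:
  assumes "s \<in> simplex_int" "b > 0" "simplex_bounded g" "simplex_bounded h"
  shows "kernel_mean s b (\<lambda>x. g x + h x) = kernel_mean s b g + kernel_mean s b h"
  unfolding kernel_mean_def using kernel_mean_integrable[OF assms(1,2)] assms(3,4)
  by (simp add: distrib_right)

lemma kernel_mean_diff:
  assumes "s \<in> simplex_int" "b > 0" "simplex_bounded g" "simplex_bounded h"
  shows "kernel_mean s b (\<lambda>x. g x - h x) = kernel_mean s b g - kernel_mean s b h"
  unfolding kernel_mean_def using kernel_mean_integrable[OF assms(1,2)] assms(3,4)
  by (simp add: left_diff_distrib)

lemma kernel_mean_cmult: "kernel_mean s b (\<lambda>x. c * g x) = c * kernel_mean s b g"
  unfolding kernel_mean_def by (simp add: mult.assoc)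

lemma kernel_mean_sum:
  assumes "s \<in> simplex_int" "b > 0" "\<And>i. i \<in> I \<Longrightarrow> simplex_bounded (g i)"
  shows "kernel_mean s b (\<lambda>x. \<Sum>i\<in>I. g i x) = (\<Sum>i\<in>I. kernel_mean s b (g i))"
  unfolding kernel_mean_def using kernel_mean_integrable[OF assms(1,2)] assms(3)
  by (simp add: sum_distrib_right)

lemma kernel_mean_mono:
  assumes "s \<in> simplex_int" "b > 0" "simplex_bounded g" "simplex_bounded h"
    and le: "\<And>x. x \<in> simplex_set \<Longrightarrow> g x \<le> h x"
  shows "kernel_mean s b g \<le> kernel_mean s b h"
  unfolding kernel_mean_def
proof (intro integral_mono kernel_mean_integrable assms(1-4))
  fix x show "g x * dirichlet_kernel s b x \<le> h x * dirichlet_kernel s b x"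
    using le[of x] dirichlet_kernel_nonneg[OF assms(1,2)] dirichlet_kernel_eq_0[of x s b]
    by (cases "x \<in> simplex_set") (auto intro: mult_right_mono)
qed

lemma kernel_mean_abs_le:
  assumes "s \<in> simplex_int" "b > 0" "simplex_bounded g" "simplex_bounded h"
    and le: "\<And>x. x \<in> simplex_set \<Longrightarrow> \<bar>g x\<bar> \<le> h x"
  shows "\<bar>kernel_mean s b g\<bar> \<le> kernel_mean s b h"
proof -
  have "kernel_mean s b (\<lambda>x. - 1 * g x) \<le> kernel_mean s b h"
    using le by (intro kernel_mean_mono assms simplex_bounded_cmult) (fastforce simp: abs_le_iff)
  moreover have "kernel_mean s b g \<le> kernel_mean s b h"
    using le by (intro kernel_mean_mono assms) (auto simp: abs_le_iff)
  ultimately show ?thesis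
    unfolding kernel_mean_cmult by simp
qed

lemma kernel_mean_const:
  assumes "s \<in> simplex_int" "b > 0"
  shows "kernel_mean s b (\<lambda>x. c) = c"
  using dirichlet_moments(1)[OF dirichlet_kernel_params[OF assms] refl]
  unfolding kernel_mean_def dirichlet_kernel_def by simp

text \<open>
  The raw moments of one coordinate are products of the fractions \<open>(s\<^sub>i + k b) / (1 + b (D + k - 1))\<close>. In the central moments the
  terms of order 1 cancel, and in the fourth also those of order \<open>b\<close>. The exact numerators show these cancellations.
\<close>

lemma kernel_central_moments:
  fixes s :: "real ^ 'd"
  assumes s: "s \<in> simplex_int" and b: "b > 0"
  defines "D \<equiv> real CARD('d) + 1"
  shows "kernel_mean s b (\<lambda>x. x $ i - s $ i) = b * (1 - D * s $ i) / (1 + b * D)"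
    and "kernel_mean s b (\<lambda>x. (x $ i - s $ i) * (x $ j - s $ j)) =
      (b * (s $ i * (of_bool (i = j) - s $ j)) +
       b\<^sup>2 * (1 + of_bool (i = j) - (D + 1) * s $ i - (D + 1) * s $ j + D * (D + 1) * s $ i * s $ j))
      / ((1 + b * D) * (1 + b * (D + 1)))"
    and "kernel_mean s b (\<lambda>x. (x $ i - s $ i) ^ 4) =
      (b^2 * (3 * s $ i ^ 2 - 6 * s $ i ^ 3 + 3 * s $ i ^ 4)
       + b^3 * (26 * s $ i - (20 * D + 72) * s $ i ^ 2 + (6 * D^2 + 42 * D + 64) * s $ i ^ 3
                - (6 * D^2 + 22 * D + 18) * s $ i ^ 4)
       + b^4 * (24 - (24 * D + 72) * s $ i + (12 * D^2 + 60 * D + 72) * s $ i ^ 2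
                - (4 * D^3 + 24 * D^2 + 44 * D + 24) * s $ i ^ 3 + (D^4 + 6 * D^3 + 11 * D^2 + 6 * D) * s $ i ^ 4))
      / ((1 + b * D) * (1 + b * (D + 1)) * (1 + b * (D + 2)) * (1 + b * (D + 3)))"
proof -
  define A where "A = 1 / b + D"
  have A: "A = (\<Sum>j\<in>UNIV. (\<chi> j. s $ j / b + 1) $ j) + ((1 - l1_norm s) / b + 1)"
    unfolding A_def D_def sum_dirichlet_kernel_params[OF s b] by simp
  note pos = dirichlet_kernel_params[OF s b]
  note mom = dirichlet_moments[OF pos A, folded dirichlet_kernel_def]
  have bdd: "simplex_bounded (\<lambda>x :: real ^ 'd. x $ i)" "simplex_bounded (\<lambda>x :: real ^ 'd. x $ i * x $ j)"
    "simplex_bounded (\<lambda>x :: real ^ 'd. c * x $ i)"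
    "simplex_bounded (\<lambda>x :: real ^ 'd. x $ i ^ n)" "simplex_bounded (\<lambda>x :: real ^ 'd. c * x $ i ^ n)" 
    "simplex_bounded (\<lambda>x :: real ^ 'd. c)" for i j c n
    by (intro simplex_bounded_continuous continuous_intros)+
  note lin = kernel_mean_add[OF s b] kernel_mean_diff[OF s b] kernel_mean_cmult kernel_mean_const[OF s b]
    simplex_bounded_add simplex_bounded_diff bdd
  have D: "D > 0" by (simp add: D_def)
  then have nz: "1 + b * (D + k) \<noteq> 0" "1 + b * D \<noteq> 0" if "k \<ge> 0" for k
    using b that by (auto simp: add_pos_nonneg intro!: less_imp_neq[symmetric])
  have A': "A + k = (1 + b * (D + k)) / b" "A = (1 + b * D) / b" for k
    using b by (simp_all add: A_def field_simps)
  have \<alpha>: "s $ i / b + 1 + k = (s $ i + b * (k + 1)) / b" "s $ i / b + 1 = (s $ i + b) / b" for i k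
    using b by (simp_all add: field_simps)
  note mom = mom[unfolded vec_lambda_beta \<alpha>(1) A'(1), unfolded \<alpha>(2) A'(2)]
  have m1: "kernel_mean s b (\<lambda>x. x $ i) = (s $ i + b) / (1 + b * D)" for i
    using mom(2)[of i] b unfolding kernel_mean_def by simp
  have m2: "kernel_mean s b (\<lambda>x. x $ i * x $ j) =
      (s $ i + b) * (s $ j + b + b * of_bool (i = j)) / ((1 + b * D) * (1 + b * (D + 1)))" for i j
  proof -
    have "s $ j + b + b * of_bool (i = j) = s $ j + b * (of_bool (i = j) + 1)"
      by (simp add: algebra_simps)
    then show ?thesis
      using mom(3)[of i j] b unfolding kernel_mean_def by (simp only:) simp
  qed
  have m2': "kernel_mean s b (\<lambda>x. x $ i ^ 2) =
      (s $ i + b) * (s $ i + 2 * b) / ((1 + b * D) * (1 + b * (D + 1)))" for i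
    using m2[of i i] by (simp add: power2_eq_square algebra_simps)
  have m3: "kernel_mean s b (\<lambda>x. x $ i ^ 3) = (s $ i + b) * (s $ i + 2 * b) * (s $ i + 3 * b)
      / ((1 + b * D) * (1 + b * (D + 1)) * (1 + b * (D + 2)))" for i
    using mom(4)[of i] b unfolding kernel_mean_def by (simp add: mult_ac)
  have m4: "kernel_mean s b (\<lambda>x. x $ i ^ 4) = (s $ i + b) * (s $ i + 2 * b) * (s $ i + 3 * b) * (s $ i + 4 * b)
      / ((1 + b * D) * (1 + b * (D + 1)) * (1 + b * (D + 2)) * (1 + b * (D + 3)))" for i
    using mom(5)[of i] b unfolding kernel_mean_def by (simp add: mult_ac)
  show "kernel_mean s b (\<lambda>x. x $ i - s $ i) = b * (1 - D * s $ i) / (1 + b * D)"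
    using nz(2)[of 0] by (simp add: lin m1 field_simps)
  have "(\<lambda>x::real^'d. (x $ i - s $ i) * (x $ j - s $ j)) =
      (\<lambda>x. x $ i * x $ j - s $ i * x $ j - s $ j * x $ i + s $ i * s $ j)"
    by (auto simp: algebra_simps)
  then have "kernel_mean s b (\<lambda>x. (x $ i - s $ i) * (x $ j - s $ j)) =
      (s $ i + b) * (s $ j + b + b * of_bool (i = j)) / ((1 + b * D) * (1 + b * (D + 1)))
      - s $ i * ((s $ j + b) / (1 + b * D)) - s $ j * ((s $ i + b) / (1 + b * D)) + s $ i * s $ j"
    by (simp only: lin m1 m2)
  also have "\<dots> = (b * (s $ i * (of_bool (i = j) - s $ j)) +
       b\<^sup>2 * (1 + of_bool (i = j) - (D + 1) * s $ i - (D + 1) * s $ j + D * (D + 1) * s $ i * s $ j))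
      / ((1 + b * D) * (1 + b * (D + 1)))"
    using nz(2)[of 0] nz(1)[of 1]
    by (simp add: divide_simps) (simp add: algebra_simps power2_eq_square)
  finally show "kernel_mean s b (\<lambda>x. (x $ i - s $ i) * (x $ j - s $ j)) = \<dots>" .
  have "(\<lambda>x::real^'d. (x $ i - s $ i) ^ 4) =
      (\<lambda>x. x $ i ^ 4 - 4 * s $ i * x $ i ^ 3 + 6 * s $ i ^ 2 * x $ i ^ 2 - 4 * s $ i ^ 3 * x $ i + s $ i ^ 4)"
    by (auto simp: algebra_simps power4_eq_xxxx power2_eq_square power3_eq_cube)
  then have "kernel_mean s b (\<lambda>x. (x $ i - s $ i) ^ 4) =
      (s $ i + b) * (s $ i + 2 * b) * (s $ i + 3 * b) * (s $ i + 4 * b)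
        / ((1 + b * D) * (1 + b * (D + 1)) * (1 + b * (D + 2)) * (1 + b * (D + 3)))
      - 4 * s $ i * ((s $ i + b) * (s $ i + 2 * b) * (s $ i + 3 * b) / ((1 + b * D) * (1 + b * (D + 1)) * (1 + b * (D + 2))))
      + 6 * s $ i ^ 2 * ((s $ i + b) * (s $ i + 2 * b) / ((1 + b * D) * (1 + b * (D + 1))))
      - 4 * s $ i ^ 3 * ((s $ i + b) / (1 + b * D)) + s $ i ^ 4"
    by (simp only: lin m1 m2' m3 m4)
  also have "\<dots> = (b^2 * (3 * s $ i ^ 2 - 6 * s $ i ^ 3 + 3 * s $ i ^ 4)
       + b^3 * (26 * s $ i - (20 * D + 72) * s $ i ^ 2 + (6 * D^2 + 42 * D + 64) * s $ i ^ 3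
                - (6 * D^2 + 22 * D + 18) * s $ i ^ 4)
       + b^4 * (24 - (24 * D + 72) * s $ i + (12 * D^2 + 60 * D + 72) * s $ i ^ 2
                - (4 * D^3 + 24 * D^2 + 44 * D + 24) * s $ i ^ 3 + (D^4 + 6 * D^3 + 11 * D^2 + 6 * D) * s $ i ^ 4))
      / ((1 + b * D) * (1 + b * (D + 1)) * (1 + b * (D + 2)) * (1 + b * (D + 3)))"
  proof -
    have clear: "n4 / (d0 * d1 * d2 * d3) - c3 * (n3 / (d0 * d1 * d2)) + c2 * (n2 / (d0 * d1)) - c1 * (n1 / d0) + c0
        = (n4 - c3 * n3 * d3 + c2 * n2 * d2 * d3 - c1 * n1 * d1 * d2 * d3 + c0 * d0 * d1 * d2 * d3) / (d0 * d1 * d2 * d3)"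
      if "d0 \<noteq> 0" "d1 \<noteq> 0" "d2 \<noteq> 0" "d3 \<noteq> 0" for n1 n2 n3 n4 c0 c1 c2 c3 d0 d1 d2 d3 :: real
      using that by (simp add: field_simps)
    have d: "1 + b * D \<noteq> 0" "1 + b * (D + 1) \<noteq> 0" "1 + b * (D + 2) \<noteq> 0" "1 + b * (D + 3) \<noteq> 0"
      by (rule nz(2)[of 0] nz(1); simp)+
    show ?thesis
      unfolding clear[OF d]
      by (rule arg_cong[where f = "\<lambda>x. x / _"]) (simp add: algebra_simps power4_eq_xxxx power2_eq_square power3_eq_cube)
  qed
  finally show "kernel_mean s b (\<lambda>x. (x $ i - s $ i) ^ 4) = \<dots>" .
qed

section \<open>Concentration of the kernel and bias for Lipschitz functions\<close>

text \<open>
  The first and second central moments are of order \<open>b\<close>, and their coefficients reappear in the bias as those of the first and,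
  up to the Taylor factor 1/2, second derivatives. That the fourth moment is \<open>o(b)\<close> makes the contribution of points far from
  \<open>s\<close> to the bias negligible.
\<close>

lemma kernel_central_moment_limits:
  fixes s :: "real ^ 'd"
  assumes s: "s \<in> simplex_int"
  shows "((\<lambda>b. kernel_mean s b (\<lambda>x. x $ i - s $ i) / b) \<longlongrightarrow> 1 - (real CARD('d) + 1) * s $ i) (at_right 0)"
    and "((\<lambda>b. kernel_mean s b (\<lambda>x. (x $ i - s $ i) * (x $ j - s $ j)) / b) \<longlongrightarrow>
           s $ i * (of_bool (i = j) - s $ j)) (at_right 0)"
    and "((\<lambda>b. kernel_mean s b (\<lambda>x. (x $ i - s $ i) ^ 4) / b) \<longlongrightarrow> 0) (at_right 0)"
proof -
  define D where "D = real CARD('d) + 1"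
  note mom = kernel_central_moments[OF s, folded D_def]
  have pos: "eventually (\<lambda>b :: real. b > 0) (at_right 0)"
    by (simp add: eventually_at_right_less)
  have "((\<lambda>b. (1 - D * s $ i) / (1 + b * D)) \<longlongrightarrow> (1 - D * s $ i) / (1 + 0 * D)) (at_right 0)"
    by (intro tendsto_intros) auto
  moreover have "eventually (\<lambda>b. (1 - D * s $ i) / (1 + b * D) = kernel_mean s b (\<lambda>x. x $ i - s $ i) / b) (at_right 0)"
    using pos by eventually_elim (simp add: mom)
  ultimately show "((\<lambda>b. kernel_mean s b (\<lambda>x. x $ i - s $ i) / b) \<longlongrightarrow> 1 - (real CARD('d) + 1) * s $ i) (at_right 0)"
    using Lim_transform_eventually by (fastforce simp: D_def)
  define p where "p = 1 + of_bool (i = j) - (D + 1) * s $ i - (D + 1) * s $ j + D * (D + 1) * s $ i * s $ j"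
  have "((\<lambda>b. (s $ i * (of_bool (i = j) - s $ j) + b * p) / ((1 + b * D) * (1 + b * (D + 1)))) \<longlongrightarrow>
      (s $ i * (of_bool (i = j) - s $ j) + 0 * p) / ((1 + 0 * D) * (1 + 0 * (D + 1)))) (at_right 0)"
    by (intro tendsto_intros) auto
  moreover have "eventually (\<lambda>b. (s $ i * (of_bool (i = j) - s $ j) + b * p) / ((1 + b * D) * (1 + b * (D + 1)))
      = kernel_mean s b (\<lambda>x. (x $ i - s $ i) * (x $ j - s $ j)) / b) (at_right 0)"
    using pos
  proof eventually_elim
    case (elim b)
    have "b * (s $ i * (of_bool (i = j) - s $ j)) + b\<^sup>2 * p = b * (s $ i * (of_bool (i = j) - s $ j) + b * p)"
      by (simp add: algebra_simps power2_eq_square)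
    then show ?case
      unfolding mom(2)[OF elim] p_def[symmetric] using elim by simp
  qed
  ultimately show "((\<lambda>b. kernel_mean s b (\<lambda>x. (x $ i - s $ i) * (x $ j - s $ j)) / b) \<longlongrightarrow>
           s $ i * (of_bool (i = j) - s $ j)) (at_right 0)"
    by (auto intro: Lim_transform_eventually)
  define p2 p3 p4 where "p2 = 3 * s $ i ^ 2 - 6 * s $ i ^ 3 + 3 * s $ i ^ 4"
    and "p3 = 26 * s $ i - (20 * D + 72) * s $ i ^ 2 + (6 * D^2 + 42 * D + 64) * s $ i ^ 3
                - (6 * D^2 + 22 * D + 18) * s $ i ^ 4"
    and "p4 = 24 - (24 * D + 72) * s $ i + (12 * D^2 + 60 * D + 72) * s $ i ^ 2
                - (4 * D^3 + 24 * D^2 + 44 * D + 24) * s $ i ^ 3 + (D^4 + 6 * D^3 + 11 * D^2 + 6 * D) * s $ i ^ 4"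
  have "((\<lambda>b. (b * p2 + b^2 * p3 + b^3 * p4) / ((1 + b * D) * (1 + b * (D + 1)) * (1 + b * (D + 2)) * (1 + b * (D + 3)))) \<longlongrightarrow>
      (0 * p2 + 0^2 * p3 + 0^3 * p4) / ((1 + 0 * D) * (1 + 0 * (D + 1)) * (1 + 0 * (D + 2)) * (1 + 0 * (D + 3)))) (at_right 0)"
    by (intro tendsto_intros) auto
  moreover have "eventually (\<lambda>b. (b * p2 + b^2 * p3 + b^3 * p4) / ((1 + b * D) * (1 + b * (D + 1)) * (1 + b * (D + 2)) * (1 + b * (D + 3)))
      = kernel_mean s b (\<lambda>x. (x $ i - s $ i) ^ 4) / b) (at_right 0)"
    using pos
  proof eventually_elim
    case (elim b)
    have "b^2 * p2 + b^3 * p3 + b^4 * p4 = b * (b * p2 + b^2 * p3 + b^3 * p4)"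
      by (simp add: algebra_simps power2_eq_square power3_eq_cube power4_eq_xxxx)
    then show ?case
      unfolding mom(3)[OF elim] p2_def[symmetric] p3_def[symmetric] p4_def[symmetric] using elim by simp
  qed
  ultimately show "((\<lambda>b. kernel_mean s b (\<lambda>x. (x $ i - s $ i) ^ 4) / b) \<longlongrightarrow> 0) (at_right 0)"
    by (auto intro: Lim_transform_eventually)
qed

lemma power2_norm_vec: "norm (x :: real ^ 'd) ^ 2 = (\<Sum>i\<in>UNIV. x $ i ^ 2)"
  unfolding power2_norm_eq_inner inner_vec_def by (simp add: power2_eq_square)

lemma kernel_norm_moment_limits:
  fixes s :: "real ^ 'd"
  assumes s: "s \<in> simplex_int"
  shows "((\<lambda>b. kernel_mean s b (\<lambda>x. norm (x - s) ^ 2) / b) \<longlongrightarrow> (\<Sum>i\<in>UNIV. s $ i * (1 - s $ i))) (at_right 0)"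
    and "((\<lambda>b. kernel_mean s b (\<lambda>x. norm (x - s) ^ 4) / b) \<longlongrightarrow> 0) (at_right 0)"
proof -
  have pos: "eventually (\<lambda>b :: real. b > 0) (at_right 0)"
    by (simp add: eventually_at_right_less)
  have bdd: "simplex_bounded (\<lambda>x :: real ^ 'd. norm (x - s) ^ 4)" "simplex_bounded (\<lambda>x :: real ^ 'd. (x $ i - s $ i) ^ n)"
    "simplex_bounded (\<lambda>x. real CARD('d) * (\<Sum>i\<in>UNIV. (x $ i - s $ i) ^ 4))" "simplex_bounded (\<lambda>_. 0 :: real)" for i n
    by (intro simplex_bounded_continuous continuous_intros)+
  have "((\<lambda>b. \<Sum>i\<in>UNIV. kernel_mean s b (\<lambda>x. (x $ i - s $ i) ^ 2) / b) \<longlongrightarrow> (\<Sum>i\<in>UNIV. s $ i * (1 - s $ i))) (at_right 0)"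
    using kernel_central_moment_limits(2)[OF s, of i i for i]
    by (intro tendsto_sum) (simp add: power2_eq_square)
  moreover have "eventually (\<lambda>b. (\<Sum>i\<in>UNIV. kernel_mean s b (\<lambda>x. (x $ i - s $ i) ^ 2) / b)
      = kernel_mean s b (\<lambda>x. norm (x - s) ^ 2) / b) (at_right 0)"
    using pos
    by eventually_elim (simp add: power2_norm_vec kernel_mean_sum[OF s] bdd sum_divide_distrib)
  ultimately show "((\<lambda>b. kernel_mean s b (\<lambda>x. norm (x - s) ^ 2) / b) \<longlongrightarrow> (\<Sum>i\<in>UNIV. s $ i * (1 - s $ i))) (at_right 0)"
    by (rule Lim_transform_eventually)
  show "((\<lambda>b. kernel_mean s b (\<lambda>x. norm (x - s) ^ 4) / b) \<longlongrightarrow> 0) (at_right 0)"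
  proof (rule tendsto_sandwich[where f = "\<lambda>_. 0"])
    show "((\<lambda>b. real CARD('d) * (\<Sum>i\<in>UNIV. kernel_mean s b (\<lambda>x. (x $ i - s $ i) ^ 4) / b)) \<longlongrightarrow> 0) (at_right 0)"
      by (intro tendsto_mult_right_zero tendsto_null_sum kernel_central_moment_limits(3)[OF s])
    show "eventually (\<lambda>b. kernel_mean s b (\<lambda>x. norm (x - s) ^ 4) / b \<le>
       real CARD('d) * (\<Sum>i\<in>UNIV. kernel_mean s b (\<lambda>x. (x $ i - s $ i) ^ 4) / b)) (at_right 0)"
      using pos
    proof eventually_elim
      case (elim b)
      have "norm (x - s) ^ 4 \<le> real CARD('d) * (\<Sum>i\<in>UNIV. (x $ i - s $ i) ^ 4)" for x
      proof -
        have "norm (x - s) ^ 4 = (norm (x - s) ^ 2) ^ 2"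
          by (simp flip: power_mult)
        also have "\<dots> = (\<Sum>i\<in>UNIV. (x $ i - s $ i) ^ 2) ^ 2"
          by (simp add: power2_norm_vec)
        also have "\<dots> \<le> (\<Sum>i\<in>UNIV. ((x $ i - s $ i) ^ 2) ^ 2) * real CARD('d)"
          by (intro sum_squared_le_sum_of_squares)
        also have "\<dots> = real CARD('d) * (\<Sum>i\<in>UNIV. (x $ i - s $ i) ^ 4)"
          by (simp add: mult.commute flip: power_mult)
        finally show ?thesis .
      qed
      then have "kernel_mean s b (\<lambda>x. norm (x - s) ^ 4) \<le> kernel_mean s b (\<lambda>x. real CARD('d) * (\<Sum>i\<in>UNIV. (x $ i - s $ i) ^ 4))"
        by (intro kernel_mean_mono[OF s elim] bdd)
      also have "\<dots> = real CARD('d) * (\<Sum>i\<in>UNIV. kernel_mean s b (\<lambda>x. (x $ i - s $ i) ^ 4))"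
        by (simp add: kernel_mean_cmult kernel_mean_sum[OF s elim] bdd)
      finally show ?case
        using elim by (simp add: sum_divide_distrib[symmetric] divide_right_mono)
    qed
    show "eventually (\<lambda>b. 0 \<le> kernel_mean s b (\<lambda>x. norm (x - s) ^ 4) / b) (at_right 0)"
      using pos
    proof eventually_elim
      case (elim b)
      have "kernel_mean s b (\<lambda>x. 0) \<le> kernel_mean s b (\<lambda>x. norm (x - s) ^ 4)"
        by (intro kernel_mean_mono[OF s elim] bdd) auto
      then show ?case
        using elim by (simp add: kernel_mean_const[OF s elim])
    qed
  qed auto
qed

lemma kernel_norm_second_moment_tendsto_0:
  assumes s: "s \<in> simplex_int"
  shows "((\<lambda>b. kernel_mean s b (\<lambda>x. norm (x - s) ^ 2)) \<longlongrightarrow> 0) (at_right 0)"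
proof -
  have "((\<lambda>b. kernel_mean s b (\<lambda>x. norm (x - s) ^ 2) / b * b) \<longlongrightarrow> (\<Sum>i\<in>UNIV. s $ i * (1 - s $ i)) * 0) (at_right 0)"
    by (intro tendsto_mult kernel_norm_moment_limits(1)[OF s]) (auto intro: tendsto_ident_at)
  moreover have "eventually (\<lambda>b. kernel_mean s b (\<lambda>x. norm (x - s) ^ 2) / b * b = kernel_mean s b (\<lambda>x. norm (x - s) ^ 2)) (at_right 0)"
    by (auto simp: eventually_at_filter)
  ultimately show ?thesis
    using Lim_transform_eventually by fastforce
qed

text \<open>
  Chebyshev's argument: near \<open>s\<close> the difference \<open>\<bar>g x - g s\<bar>\<close> is small, and at distance at least \<open>r\<close> it is bounded by
  \<open>2B \<parallel>x - s\<parallel>\<^sup>2 / r\<^sup>2\<close>, whose mean tends to 0.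
\<close>

lemma kernel_mean_tendsto:
  fixes s :: "real ^ 'd"
  assumes s: "s \<in> simplex_int" and g: "simplex_bounded g"
    and cont: "(g \<longlongrightarrow> g s) (at s within simplex_set)"
  shows "((\<lambda>b. kernel_mean s b g) \<longlongrightarrow> g s) (at_right 0)"
proof (rule tendstoI)
  fix e :: real assume "e > 0"
  obtain B where B: "\<And>x. x \<in> simplex_set \<Longrightarrow> \<bar>g x\<bar> \<le> B"
    using g by (auto simp: simplex_bounded_def)
  from cont \<open>e > 0\<close> have "eventually (\<lambda>x. dist (g x) (g s) < e / 2) (at s within simplex_set)"
    by (intro tendstoD) auto
  then obtain r where r: "r > 0" "\<And>x. x \<in> simplex_set \<Longrightarrow> x \<noteq> s \<Longrightarrow> dist x s < r \<Longrightarrow> dist (g x) (g s) < e / 2"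
    by (auto simp: eventually_at)
  have s_in: "s \<in> simplex_set"
    using simplex_int_subset_interior[OF s] interior_subset by blast
  define C where "C = 2 * B / r\<^sup>2"
  have C: "C \<ge> 0"
    using B[OF s_in] by (simp add: C_def)
  have bd: "\<bar>g x - g s\<bar> \<le> e / 2 + C * norm (x - s) ^ 2" if x: "x \<in> simplex_set" for x
  proof (cases "dist x s < r")
    case True
    then have "\<bar>g x - g s\<bar> \<le> e / 2"
      using r(2)[OF x] \<open>e > 0\<close> by (cases "x = s") (auto simp: dist_real_def)
    then show ?thesis
      using C by (simp add: add_increasing2)
  next
    case False
    then have "r\<^sup>2 \<le> norm (x - s) ^ 2"
      using r(1) by (intro power_mono) (auto simp: dist_norm)
    then have "C * r\<^sup>2 \<le> C * norm (x - s) ^ 2"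
      using C by (rule mult_left_mono)
    moreover have "C * r\<^sup>2 = 2 * B"
      using r(1) by (simp add: C_def)
    moreover have "\<bar>g x - g s\<bar> \<le> 2 * B"
      using B[OF x] B[OF s_in] by linarith
    ultimately show ?thesis
      using \<open>e > 0\<close> by linarith
  qed
  have bdd: "simplex_bounded (\<lambda>x :: real ^ 'd. c)" "simplex_bounded (\<lambda>x :: real ^ 'd. norm (x - s) ^ 2)" for c
    by (intro simplex_bounded_continuous continuous_intros)+
  have "((\<lambda>b. e / 2 + C * kernel_mean s b (\<lambda>x. norm (x - s) ^ 2)) \<longlongrightarrow> e / 2 + C * 0) (at_right 0)"
    by (intro tendsto_intros kernel_norm_second_moment_tendsto_0[OF s])
  then have "eventually (\<lambda>b. e / 2 + C * kernel_mean s b (\<lambda>x. norm (x - s) ^ 2) < e) (at_right 0)"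
    using \<open>e > 0\<close> by (auto elim: order_tendstoD)
  then show "eventually (\<lambda>b. dist (kernel_mean s b g) (g s) < e) (at_right 0)"
    using eventually_at_right_less[of 0]
  proof eventually_elim
    case (elim b)
    have "kernel_mean s b g - g s = kernel_mean s b (\<lambda>x. g x - g s)"
      by (simp add: kernel_mean_diff[OF s elim(2)] kernel_mean_const[OF s elim(2)] g bdd)
    moreover have "\<bar>kernel_mean s b (\<lambda>x. g x - g s)\<bar> \<le> kernel_mean s b (\<lambda>x. e / 2 + C * norm (x - s) ^ 2)"
      by (intro kernel_mean_abs_le s elim(2) simplex_bounded_diff simplex_bounded_add simplex_bounded_cmult g bdd bd)
    moreover have "\<dots> = e / 2 + C * kernel_mean s b (\<lambda>x. norm (x - s) ^ 2)"
      by (simp add: kernel_mean_add[OF s elim(2)] kernel_mean_const[OF s elim(2)] kernel_mean_cmult simplex_bounded_cmult bdd)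
    ultimately show ?case
      using elim(1) by (simp add: dist_real_def)
  qed
qed

text \<open>
  The bias is at most \<open>L\<close> times the mean distance from \<open>s\<close>. The pointwise bound \<open>2 \<parallel>x - s\<parallel> \<le> \<surd>b + \<parallel>x - s\<parallel>\<^sup>2 / \<surd>b\<close>
  reduces it to the second moment, which is of order \<open>b\<close>.
\<close>

lemma kernel_bias_lipschitz:
  fixes s :: "real ^ 'd"
  assumes s: "s \<in> simplex_int" and g: "simplex_bounded g" and L: "L-lipschitz_on simplex_set g"
  obtains C where "eventually (\<lambda>b. \<bar>kernel_mean s b g - g s\<bar> \<le> C * sqrt b) (at_right 0)"
proof -
  have s_in: "s \<in> simplex_set"
    using simplex_int_subset_interior[OF s] interior_subset by blast
  have L0: "L \<ge> 0"
    using L by (rule lipschitz_on_nonneg)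
  define V where "V = (\<Sum>i\<in>UNIV. s $ i * (1 - s $ i)) + 1"
  have bdd: "simplex_bounded (\<lambda>x :: real ^ 'd. c)" "simplex_bounded (\<lambda>x :: real ^ 'd. norm (x - s) ^ 2)" for c
    by (intro simplex_bounded_continuous continuous_intros)+
  have "eventually (\<lambda>b. kernel_mean s b (\<lambda>x. norm (x - s) ^ 2) / b < V) (at_right 0)"
    by (rule order_tendstoD(2)[OF kernel_norm_moment_limits(1)[OF s]]) (simp add: V_def)
  then have "eventually (\<lambda>b. \<bar>kernel_mean s b g - g s\<bar> \<le> (L / 2 * (1 + V)) * sqrt b) (at_right 0)"
    using eventually_at_right_less[of 0]
  proof eventually_elim
    case (elim b)
    define w where "w = sqrt b"
    have w: "w > 0" "w * w = b"
      using elim(2) by (auto simp: w_def)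
    have bd: "\<bar>g x - g s\<bar> \<le> L / 2 * w + L / (2 * w) * norm (x - s) ^ 2" if x: "x \<in> simplex_set" for x
    proof -
      have "0 \<le> (norm (x - s) - w) ^ 2 / w"
        using w by simp
      also have "\<dots> = norm (x - s) ^ 2 / w + w - 2 * norm (x - s)"
        using w(1) by (simp add: power2_eq_square field_simps)
      finally have "norm (x - s) \<le> w / 2 + norm (x - s) ^ 2 / (2 * w)"
        by simp
      then have "L * norm (x - s) \<le> L * (w / 2 + norm (x - s) ^ 2 / (2 * w))"
        using L0 by (rule mult_left_mono)
      moreover have "\<bar>g x - g s\<bar> \<le> L * norm (x - s)"
        using lipschitz_onD[OF L x s_in] by (simp add: dist_norm)
      ultimately show ?thesis
        by (simp add: distrib_left)
    qed
    have "kernel_mean s b g - g s = kernel_mean s b (\<lambda>x. g x - g s)"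
      by (simp add: kernel_mean_diff[OF s elim(2)] kernel_mean_const[OF s elim(2)] g bdd)
    moreover have "\<bar>kernel_mean s b (\<lambda>x. g x - g s)\<bar> \<le> kernel_mean s b (\<lambda>x. L / 2 * w + L / (2 * w) * norm (x - s) ^ 2)"
      by (intro kernel_mean_abs_le s elim(2) simplex_bounded_diff simplex_bounded_add simplex_bounded_cmult g bdd bd)
    moreover have "\<dots> = L / 2 * w + L / (2 * w) * kernel_mean s b (\<lambda>x. norm (x - s) ^ 2)"
      by (simp only: kernel_mean_add[OF s elim(2)] kernel_mean_const[OF s elim(2)] kernel_mean_cmult simplex_bounded_cmult bdd)
    moreover have "L / (2 * w) * kernel_mean s b (\<lambda>x. norm (x - s) ^ 2) \<le> L / (2 * w) * (V * b)"
      using elim L0 w(1) by (intro mult_left_mono) (auto simp: divide_less_eq)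
    moreover have "L / (2 * w) * (V * b) = L / 2 * V * w"
      using w(1) by (simp add: w(2)[symmetric])
    ultimately show ?case
      by (simp add: w_def[symmetric] algebra_simps)
  qed
  then show thesis
    by (rule that)
qed

section \<open>Bias for twice continuously differentiable functions\<close>

text \<open>
  The mean value theorem is applied along the segment from \<open>s\<close> to \<open>x\<close> to the difference of \<open>f\<close> and its
  quadratic approximation. The derivative of that difference is the first-order remainder of \<open>G\<close> at
  \<open>s\<close>, paired with \<open>x - s\<close>. Hence differentiability of the gradient at the single point \<open>s\<close> suffices.
\<close>

lemma taylor2_peano:
  fixes f :: "'v::euclidean_space \<Rightarrow> real"
  assumes s: "s \<in> interior S"
    and f: "\<And>x. x \<in> S \<Longrightarrow> (f has_derivative (\<lambda>h. G x \<bullet> h)) (at x within S)"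
    and G: "(G has_derivative A) (at s within S)"
    and e: "e > 0"
  obtains \<delta> where "\<delta> > 0" "\<And>x. norm (x - s) < \<delta> \<Longrightarrow>
     \<bar>f x - f s - G s \<bullet> (x - s) - 1/2 * (A (x - s) \<bullet> (x - s))\<bar> \<le> e * norm (x - s) ^ 2"
proof -
  from s obtain r where r: "r > 0" "ball s r \<subseteq> interior S"
    using open_contains_ball[of "interior S"] by auto
  have "(G has_derivative A) (at s)"
    using G at_within_interior[OF s] by simp
  then obtain d where lin: "bounded_linear A" and d: "d > 0"
      "\<And>y. norm (y - s) < d \<Longrightarrow> norm (G y - G s - A (y - s)) \<le> e * norm (y - s)"
    using e unfolding has_derivative_at_alt by meson
  interpret A: bounded_linear A by fact
  show thesis
  proof (rule that[of "min d r"])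
    show "min d r > 0" using d(1) r(1) by simp
    fix x assume x: "norm (x - s) < min d r"
    define h where "h = x - s"
    define \<phi> where "\<phi> t = f (s + t *\<^sub>R h) - t * (G s \<bullet> h) - t\<^sup>2 / 2 * (A h \<bullet> h)" for t
    have \<phi>': "(\<phi> has_real_derivative (G (s + t *\<^sub>R h) - G s - A (t *\<^sub>R h)) \<bullet> h) (at t)"
      if t: "0 \<le> t" "t \<le> 1" for t
    proof -
      have "norm (t *\<^sub>R h) \<le> norm h"
        using t mult_right_mono[of "\<bar>t\<bar>" 1 "norm h"] by simp
      then have "s + t *\<^sub>R h \<in> ball s r"
        using x unfolding h_def by (simp add: dist_norm)
      then have "s + t *\<^sub>R h \<in> interior S"
        using r(2) by blast
      then have "at (s + t *\<^sub>R h) within S = at (s + t *\<^sub>R h)" "s + t *\<^sub>R h \<in> S"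
        using at_within_interior interior_subset by blast+
      then have outer: "(f has_derivative (\<lambda>k. G (s + t *\<^sub>R h) \<bullet> k)) (at (s + t *\<^sub>R h))"
        using f[of "s + t *\<^sub>R h"] by (simp only:)
      have inner: "((\<lambda>t. s + t *\<^sub>R h) has_derivative (\<lambda>k. k *\<^sub>R h)) (at t)"
        by (auto intro!: derivative_eq_intros)
      have comp: "((\<lambda>t. f (s + t *\<^sub>R h)) has_derivative (\<lambda>k. G (s + t *\<^sub>R h) \<bullet> (k *\<^sub>R h))) (at t)"
        by (rule has_derivative_compose[where f = "\<lambda>t. s + t *\<^sub>R h" and g = f, OF inner outer])
      have 1: "((\<lambda>t. f (s + t *\<^sub>R h)) has_real_derivative G (s + t *\<^sub>R h) \<bullet> h) (at t)"
      proof -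
        have "(\<lambda>k. G (s + t *\<^sub>R h) \<bullet> (k *\<^sub>R h)) = (*) (G (s + t *\<^sub>R h) \<bullet> h)"
          by (simp add: fun_eq_iff)
        then show ?thesis
          using comp by (simp only: has_field_derivative_def)
      qed
      have 2: "((\<lambda>t. t * (G s \<bullet> h)) has_real_derivative G s \<bullet> h) (at t)"
        by (auto intro!: derivative_eq_intros)
      have 3: "((\<lambda>t. t\<^sup>2 / 2 * (A h \<bullet> h)) has_real_derivative t * (A h \<bullet> h)) (at t)"
        by (auto intro!: derivative_eq_intros)
      have "(\<phi> has_real_derivative G (s + t *\<^sub>R h) \<bullet> h - G s \<bullet> h - t * (A h \<bullet> h)) (at t)"
        unfolding \<phi>_def by (rule DERIV_diff[OF DERIV_diff[OF 1 2] 3])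
      then show ?thesis
        by (simp add: inner_diff_left A.scaleR)
    qed
    define \<psi> where "\<psi> t = (G (s + t *\<^sub>R h) - G s - A (t *\<^sub>R h)) \<bullet> h" for t
    have "\<exists>z::real. z > 0 \<and> z < 1 \<and> \<phi> 1 - \<phi> 0 = (1 - 0) * \<psi> z"
    proof (rule MVT2)
      show "(\<phi> has_real_derivative \<psi> t) (at t)" if "0 \<le> t" "t \<le> 1" for t
        unfolding \<psi>_def by (rule \<phi>'[OF that])
    qed simp
    then obtain z where z: "0 < z" "z < 1" and eq: "\<phi> 1 - \<phi> 0 = \<psi> z"
      by auto
    have zh: "norm (z *\<^sub>R h) \<le> norm h"
      using z mult_right_mono[of "\<bar>z\<bar>" 1 "norm h"] by simp
    have "f x - f s - G s \<bullet> (x - s) - 1/2 * (A (x - s) \<bullet> (x - s)) = \<phi> 1 - \<phi> 0"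
      by (simp add: \<phi>_def h_def)
    also have "\<bar>\<dots>\<bar> \<le> norm (G (s + z *\<^sub>R h) - G s - A (z *\<^sub>R h)) * norm h"
      unfolding eq \<psi>_def by (rule Cauchy_Schwarz_ineq2)
    also have "\<dots> \<le> (e * norm h) * norm h"
    proof (rule mult_right_mono)
      have "norm (G (s + z *\<^sub>R h) - G s - A (z *\<^sub>R h)) \<le> e * norm (z *\<^sub>R h)"
        using d(2)[of "s + z *\<^sub>R h"] zh x by (simp add: h_def)
      also have "\<dots> \<le> e * norm h"
        using e zh by (intro mult_left_mono) auto
      finally show "norm (G (s + z *\<^sub>R h) - G s - A (z *\<^sub>R h)) \<le> e * norm h" .
    qed simp
    finally show "\<bar>f x - f s - G s \<bullet> (x - s) - 1/2 * (A (x - s) \<bullet> (x - s))\<bar> \<le> e * norm (x - s) ^ 2"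
      by (simp add: h_def power2_eq_square mult.assoc)
  qed
qed

lemma has_vector_derivative_along_axis:
  fixes f :: "real ^ 'd \<Rightarrow> 'v::real_normed_vector"
  assumes "(f has_derivative A) (at x)"
  shows "((\<lambda>t. f (x + t *\<^sub>R axis i 1)) has_vector_derivative A (axis i 1)) (at 0)"
proof -
  interpret A: bounded_linear A
    using assms by (rule has_derivative_bounded_linear)
  have "((\<lambda>t. x + t *\<^sub>R axis i (1::real)) has_derivative (\<lambda>k. k *\<^sub>R axis i 1)) (at 0)"
    by (auto intro!: derivative_eq_intros)
  from has_derivative_compose[where f = "\<lambda>t. x + t *\<^sub>R axis i (1::real)" and g = f and g' = A, OF this] assms
  have "((\<lambda>t. f (x + t *\<^sub>R axis i 1)) has_derivative (\<lambda>k. A (k *\<^sub>R axis i 1))) (at 0)"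
    by simp
  then show ?thesis
    by (simp add: has_vector_derivative_def A.scaleR)
qed

lemma partial_deriv_eq:
  assumes "(f has_derivative (\<lambda>h. g \<bullet> h)) (at x)"
  shows "partial_deriv i f x = g $ i"
  unfolding partial_deriv_def
  using has_vector_derivative_along_axis[OF assms, of i]
  by (intro DERIV_imp_deriv) (simp add: has_real_derivative_iff_has_vector_derivative inner_axis)

text \<open>
  The inner partial derivative agrees with a component of the gradient only in the interior of \<open>S\<close>, where derivatives within \<open>S\<close>
  are derivatives; this is enough because the outer derivative at an interior point is local.
\<close>

lemma second_partial_deriv_eq:
  fixes f :: "real ^ 'd \<Rightarrow> real"
  assumes s: "s \<in> interior S"
    and f: "\<And>x. x \<in> S \<Longrightarrow> (f has_derivative (\<lambda>h. G x \<bullet> h)) (at x within S)"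
    and G: "(G has_derivative (\<lambda>h. H *v h)) (at s within S)"
  shows "partial_deriv i (partial_deriv j f) s = H $ j $ i"
proof -
  have pd: "partial_deriv j f x = G x $ j" if "x \<in> interior S" for x
    using f[of x] that interior_subset at_within_interior[OF that] by (intro partial_deriv_eq) auto
  have "(G has_derivative (\<lambda>h. H *v h)) (at s)"
    using G at_within_interior[OF s] by simp
  from has_vector_derivative_along_axis[OF this, of i]
  have "((\<lambda>t. G (s + t *\<^sub>R axis i 1) $ j) has_vector_derivative (H *v axis i 1) $ j) (at 0)"
    by (rule bounded_linear.has_vector_derivative[OF bounded_linear_vec_nth])
  then have D: "((\<lambda>t. G (s + t *\<^sub>R axis i 1) $ j) has_real_derivative H $ j $ i) (at 0)"
    by (simp add: has_real_derivative_iff_has_vector_derivative matrix_vector_mult_basis column_def)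
  have "((\<lambda>t. s + t *\<^sub>R axis i (1::real)) \<longlongrightarrow> s + 0 *\<^sub>R axis i 1) (nhds 0)"
    by (intro tendsto_intros filterlim_ident)
  then have "eventually (\<lambda>t. s + t *\<^sub>R axis i (1::real) \<in> interior S) (nhds 0)"
    using s by (intro topological_tendstoD) auto
  then have "eventually (\<lambda>t. partial_deriv j f (s + t *\<^sub>R axis i 1) = G (s + t *\<^sub>R axis i 1) $ j) (nhds 0)"
    by eventually_elim (rule pd)
  then have "partial_deriv i (partial_deriv j f) s = deriv (\<lambda>t. G (s + t *\<^sub>R axis i 1) $ j) 0"
    unfolding partial_deriv_def[of i] by (intro deriv_cong_ev) auto
  then show ?thesis
    using DERIV_imp_deriv[OF D] by simp
qed

text \<open>
  The mean of the quadratic approximation \<open>Q\<close> is a combination of first and second central moments and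
  yields the bias coefficient. The remainder is at most \<open>e \<parallel>x - s\<parallel>\<^sup>2\<close> near \<open>s\<close> and bounded elsewhere, hence
  at most \<open>e \<parallel>x - s\<parallel>\<^sup>2 + C \<parallel>x - s\<parallel>\<^sup>4\<close> everywhere on the simplex, whose mean is at most \<open>e V b + o(b)\<close>.
\<close>

lemma kernel_bias_C2:
  fixes s :: "real ^ 'd"
  assumes s: "s \<in> simplex_int" and f: "simplex_bounded f"
    and C2: "twice_cont_differentiable_on f simplex_set"
  shows "((\<lambda>b. (kernel_mean s b f - f s) / b) \<longlongrightarrow> bias_coeff f s) (at_right 0)"
proof -
  from C2 obtain G and H :: "real ^ 'd \<Rightarrow> real ^ 'd ^ 'd" where
    fG: "\<And>x. x \<in> simplex_set \<Longrightarrow> (f has_derivative (\<lambda>h. G x \<bullet> h)) (at x within simplex_set)" and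
    GH: "\<And>x. x \<in> simplex_set \<Longrightarrow> (G has_derivative (\<lambda>h. H x *v h)) (at x within simplex_set)"
    unfolding twice_cont_differentiable_on_def by blast
  have s_int: "s \<in> interior simplex_set"
    by (rule simplex_int_subset_interior[OF s])
  then have s_in: "s \<in> simplex_set"
    using interior_subset by blast
  have p1: "partial_deriv i f s = G s $ i" for i
    using fG[OF s_in] at_within_interior[OF s_int] by (intro partial_deriv_eq) auto
  have p2: "partial_deriv i (partial_deriv j f) s = H s $ j $ i" for i j
    by (rule second_partial_deriv_eq[OF s_int fG GH[OF s_in]])
  define Q where "Q x = f s + (\<Sum>i\<in>UNIV. G s $ i * (x $ i - s $ i))
     + 1/2 * (\<Sum>i\<in>UNIV. \<Sum>j\<in>UNIV. H s $ j $ i * ((x $ i - s $ i) * (x $ j - s $ j)))" for x :: "real ^ 'd"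
  have bdd: "simplex_bounded (\<lambda>x :: real ^ 'd. c)" "simplex_bounded (\<lambda>x :: real ^ 'd. norm (x - s) ^ n)"
    "simplex_bounded (\<lambda>x :: real ^ 'd. c * norm (x - s) ^ n)"
    "simplex_bounded (\<lambda>x :: real ^ 'd. x $ i - s $ i)" "simplex_bounded (\<lambda>x :: real ^ 'd. c * (x $ i - s $ i))"
    "simplex_bounded (\<lambda>x :: real ^ 'd. (x $ i - s $ i) * (x $ j - s $ j))"
    "simplex_bounded (\<lambda>x :: real ^ 'd. c * ((x $ i - s $ i) * (x $ j - s $ j)))"
    "simplex_bounded (\<lambda>x :: real ^ 'd. \<Sum>i\<in>UNIV. G s $ i * (x $ i - s $ i))"
    "simplex_bounded (\<lambda>x :: real ^ 'd. \<Sum>j\<in>UNIV. H s $ j $ i * ((x $ i - s $ i) * (x $ j - s $ j)))"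
    "simplex_bounded (\<lambda>x :: real ^ 'd. c * (\<Sum>i\<in>UNIV. \<Sum>j\<in>UNIV. H s $ j $ i * ((x $ i - s $ i) * (x $ j - s $ j))))"
    "simplex_bounded Q" for c n i j
    unfolding Q_def[abs_def] by (intro simplex_bounded_continuous continuous_intros)+
  have pos: "eventually (\<lambda>b :: real. b > 0) (at_right 0)"
    by (simp add: eventually_at_right_less)
  have "((\<lambda>b. (\<Sum>i\<in>UNIV. G s $ i * (kernel_mean s b (\<lambda>x. x $ i - s $ i) / b))
     + 1/2 * (\<Sum>i\<in>UNIV. \<Sum>j\<in>UNIV. H s $ j $ i * (kernel_mean s b (\<lambda>x. (x $ i - s $ i) * (x $ j - s $ j)) / b)))
     \<longlongrightarrow> (\<Sum>i\<in>UNIV. G s $ i * (1 - (real CARD('d) + 1) * s $ i))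
     + 1/2 * (\<Sum>i\<in>UNIV. \<Sum>j\<in>UNIV. H s $ j $ i * (s $ i * (of_bool (i = j) - s $ j)))) (at_right 0)"
    by (intro tendsto_intros kernel_central_moment_limits[OF s])
  also have "(\<Sum>i\<in>UNIV. G s $ i * (1 - (real CARD('d) + 1) * s $ i))
     + 1/2 * (\<Sum>i\<in>UNIV. \<Sum>j\<in>UNIV. H s $ j $ i * (s $ i * (of_bool (i = j) - s $ j))) = bias_coeff f s"
    unfolding bias_coeff_def p1 p2 by (simp add: mult_ac)
  finally have "((\<lambda>b. (\<Sum>i\<in>UNIV. G s $ i * (kernel_mean s b (\<lambda>x. x $ i - s $ i) / b))
     + 1/2 * (\<Sum>i\<in>UNIV. \<Sum>j\<in>UNIV. H s $ j $ i * (kernel_mean s b (\<lambda>x. (x $ i - s $ i) * (x $ j - s $ j)) / b)))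
     \<longlongrightarrow> bias_coeff f s) (at_right 0)" .
  moreover have "eventually (\<lambda>b. (\<Sum>i\<in>UNIV. G s $ i * (kernel_mean s b (\<lambda>x. x $ i - s $ i) / b))
     + 1/2 * (\<Sum>i\<in>UNIV. \<Sum>j\<in>UNIV. H s $ j $ i * (kernel_mean s b (\<lambda>x. (x $ i - s $ i) * (x $ j - s $ j)) / b))
     = (kernel_mean s b Q - f s) / b) (at_right 0)"
    using pos
  proof eventually_elim
    case (elim b)
    have "kernel_mean s b Q = f s + (\<Sum>i\<in>UNIV. G s $ i * kernel_mean s b (\<lambda>x. x $ i - s $ i))
      + 1/2 * (\<Sum>i\<in>UNIV. \<Sum>j\<in>UNIV. H s $ j $ i * kernel_mean s b (\<lambda>x. (x $ i - s $ i) * (x $ j - s $ j)))"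
      unfolding Q_def[abs_def]
      by (simp only: kernel_mean_add[OF s elim] kernel_mean_sum[OF s elim] kernel_mean_cmult kernel_mean_const[OF s elim] bdd simplex_bounded_add)
    then show ?case
      using elim by (simp add: add_divide_distrib sum_divide_distrib mult_ac)
  qed
  ultimately have main: "((\<lambda>b. (kernel_mean s b Q - f s) / b) \<longlongrightarrow> bias_coeff f s) (at_right 0)"
    by (rule Lim_transform_eventually)
  have Q_taylor: "f x - f s - G s \<bullet> (x - s) - 1/2 * ((H s *v (x - s)) \<bullet> (x - s)) = f x - Q x" for x
  proof -
    have "(H s *v (x - s)) \<bullet> (x - s) = (\<Sum>j\<in>UNIV. \<Sum>i\<in>UNIV. H s $ j $ i * ((x $ i - s $ i) * (x $ j - s $ j)))"
      by (simp add: inner_vec_def matrix_vector_mult_def sum_distrib_left sum_distrib_right mult_ac)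
    also have "\<dots> = (\<Sum>i\<in>UNIV. \<Sum>j\<in>UNIV. H s $ j $ i * ((x $ i - s $ i) * (x $ j - s $ j)))"
      by (rule sum.swap)
    finally show ?thesis
      by (simp add: Q_def inner_vec_def)
  qed
  define V where "V = (\<Sum>i\<in>UNIV. s $ i * (1 - s $ i))"
  have V: "V \<ge> 0"
    using s unfolding V_def by (intro sum_nonneg) (simp add: simplex_int_def less_imp_le)
  have rem: "((\<lambda>b. kernel_mean s b (\<lambda>x. f x - Q x) / b) \<longlongrightarrow> 0) (at_right 0)"
  proof (rule tendstoI)
    fix \<epsilon> :: real assume \<epsilon>: "\<epsilon> > 0"
    define e where "e = \<epsilon> / (2 * (V + 1))"
    have e: "e > 0" "e * V < \<epsilon>"
      using \<epsilon> V by (auto simp: e_def field_simps add_nonneg_pos intro: add_nonneg_pos)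
    obtain \<delta> where \<delta>: "\<delta> > 0" "\<And>x. norm (x - s) < \<delta> \<Longrightarrow> \<bar>f x - Q x\<bar> \<le> e * norm (x - s) ^ 2"
      using taylor2_peano[OF s_int fG GH[OF s_in] e(1)] unfolding Q_taylor by blast
    have fQ: "simplex_bounded (\<lambda>x. f x - Q x)"
      by (intro simplex_bounded_diff f bdd)
    then obtain B where B: "\<And>x. x \<in> simplex_set \<Longrightarrow> \<bar>f x - Q x\<bar> \<le> B"
      by (auto simp: simplex_bounded_def)
    have B0: "B \<ge> 0"
      using B[OF s_in] by linarith
    define C where "C = B / \<delta> ^ 4"
    have C: "C \<ge> 0"
      using B0 by (simp add: C_def)
    have bd: "\<bar>f x - Q x\<bar> \<le> e * norm (x - s) ^ 2 + C * norm (x - s) ^ 4" if x: "x \<in> simplex_set" for x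
    proof (cases "norm (x - s) < \<delta>")
      case True
      then show ?thesis
        using \<delta>(2)[of x] C by (simp add: add_increasing2)
    next
      case False
      then have "\<delta> ^ 4 \<le> norm (x - s) ^ 4"
        using \<delta>(1) by (intro power_mono) auto
      then have "C * \<delta> ^ 4 \<le> C * norm (x - s) ^ 4"
        using C by (rule mult_left_mono)
      moreover have "C * \<delta> ^ 4 = B"
        using \<delta>(1) by (simp add: C_def)
      moreover have "0 \<le> e * norm (x - s) ^ 2"
        using e(1) by simp
      ultimately show ?thesis
        using B[OF x] by linarith
    qed
    have "((\<lambda>b. e * (kernel_mean s b (\<lambda>x. norm (x - s) ^ 2) / b) + C * (kernel_mean s b (\<lambda>x. norm (x - s) ^ 4) / b))
        \<longlongrightarrow> e * V + C * 0) (at_right 0)"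
      unfolding V_def by (intro tendsto_intros kernel_norm_moment_limits[OF s])
    then have "eventually (\<lambda>b. e * (kernel_mean s b (\<lambda>x. norm (x - s) ^ 2) / b) + C * (kernel_mean s b (\<lambda>x. norm (x - s) ^ 4) / b) < \<epsilon>) (at_right 0)"
      using e(2) by (auto elim: order_tendstoD)
    then show "eventually (\<lambda>b. dist (kernel_mean s b (\<lambda>x. f x - Q x) / b) 0 < \<epsilon>) (at_right 0)"
      using pos
    proof eventually_elim
      case (elim b)
      have "\<bar>kernel_mean s b (\<lambda>x. f x - Q x)\<bar> \<le> kernel_mean s b (\<lambda>x. e * norm (x - s) ^ 2 + C * norm (x - s) ^ 4)"
        by (intro kernel_mean_abs_le s elim(2) fQ simplex_bounded_add bdd bd)
      also have "\<dots> = e * kernel_mean s b (\<lambda>x. norm (x - s) ^ 2) + C * kernel_mean s b (\<lambda>x. norm (x - s) ^ 4)"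
        by (simp only: kernel_mean_add[OF s elim(2)] kernel_mean_cmult bdd)
      finally have "\<bar>kernel_mean s b (\<lambda>x. f x - Q x)\<bar> / b \<le>
          (e * kernel_mean s b (\<lambda>x. norm (x - s) ^ 2) + C * kernel_mean s b (\<lambda>x. norm (x - s) ^ 4)) / b"
        using elim(2) by (intro divide_right_mono) auto
      then show ?case
        using elim by (simp add: dist_real_def add_divide_distrib)
    qed
  qed
  from tendsto_add[OF main rem]
  have "((\<lambda>b. (kernel_mean s b Q - f s) / b + kernel_mean s b (\<lambda>x. f x - Q x) / b) \<longlongrightarrow> bias_coeff f s) (at_right 0)"
    by simp
  then show ?thesis
  proof (rule Lim_transform_eventually)
    show "eventually (\<lambda>b. (kernel_mean s b Q - f s) / b + kernel_mean s b (\<lambda>x. f x - Q x) / b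
       = (kernel_mean s b f - f s) / b) (at_right 0)"
      using pos
      by eventually_elim (simp add: kernel_mean_diff[OF s] f bdd add_divide_distrib[symmetric])
  qed
qed

section \<open>Lyapunov's theorem for triangular arrays\<close>

lemma char_distr_affine:
  fixes Y :: "'a \<Rightarrow> real"
  assumes [measurable]: "Y \<in> borel_measurable M"
  shows "char (distr M borel (\<lambda>\<omega>. a * Y \<omega> + c)) t = exp (\<i> * of_real (t * c)) * char (distr M borel Y) (t * a)"
proof -
  have "char (distr M borel (\<lambda>\<omega>. a * Y \<omega> + c)) t = (CLINT \<omega>|M. iexp (t * c) * iexp (t * a * Y \<omega>))"
    unfolding char_def by (subst integral_distr) (auto simp: exp_add[symmetric] algebra_simps)
  then show ?thesis
    unfolding char_def by (simp add: integral_distr)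
qed

lemma normal_distribution_eq_distr:
  assumes "v > 0"
  shows "normal_distribution \<mu> v = distr std_normal_distribution borel (\<lambda>x. sqrt v * x + \<mu>)"
proof -
  interpret N: prob_space std_normal_distribution
    by (rule prob_space_normal_density) simp
  have "distributed std_normal_distribution lborel (\<lambda>x. x) (\<lambda>x. ennreal (normal_density 0 1 x))"
    by (auto simp: distributed_def distr_id2)
  from N.normal_density_affine[OF this, of "sqrt v" \<mu>] assms
  have "distributed std_normal_distribution lborel (\<lambda>x. \<mu> + sqrt v * x) (\<lambda>x. ennreal (normal_density \<mu> (sqrt v) x))"
    by simp
  then have "distr std_normal_distribution lborel (\<lambda>x. \<mu> + sqrt v * x) = normal_distribution \<mu> v"
    by (simp add: distributed_def normal_distribution_def)
  then show ?thesis
    by (simp add: add.commute cong: distr_cong)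
qed

lemma char_normal_distribution:
  assumes "v > 0"
  shows "char (normal_distribution \<mu> v) t = exp (\<i> * of_real (t * \<mu>)) * of_real (exp (- t\<^sup>2 * v / 2))"
proof -
  have "distr std_normal_distribution borel (\<lambda>x. x) = std_normal_distribution"
    by (rule distr_id2) simp
  then have "char (normal_distribution \<mu> v) t = exp (\<i> * of_real (t * \<mu>)) * char std_normal_distribution (t * sqrt v)"
    using char_distr_affine[of "\<lambda>x. x" std_normal_distribution "sqrt v" \<mu> t] assms
    by (simp add: normal_distribution_eq_distr)
  also have "char std_normal_distribution (t * sqrt v) = of_real (exp (- t\<^sup>2 * v / 2))"
    using assms by (simp add: char_std_normal_distribution power_mult_distrib)
  finally show ?thesis .
qed

lemma real_distribution_normal:
  assumes "v > 0"
  shows "real_distribution (normal_distribution \<mu> v)"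
  unfolding normal_distribution_eq_distr[OF assms]
  by (intro prob_space.real_distribution_distr prob_space_normal_density) auto

text \<open>
  Integrates the pointwise inequality between the arithmetic and the geometric mean of \<open>\<epsilon> y\<^sup>2\<close> and \<open>y\<^sup>4 / \<epsilon>\<close>. The free
  parameter \<open>\<epsilon>\<close> lets the third moment be controlled by the second and the fourth.
\<close>

lemma (in prob_space) third_moment_le:
  fixes Y :: "'a \<Rightarrow> real"
  assumes [measurable]: "Y \<in> borel_measurable M" and "integrable M (\<lambda>\<omega>. Y \<omega> ^ 2)" "integrable M (\<lambda>\<omega>. Y \<omega> ^ 4)" and "\<epsilon> > 0"
  shows "integrable M (\<lambda>\<omega>. \<bar>Y \<omega>\<bar> ^ 3)"
    and "expectation (\<lambda>\<omega>. \<bar>Y \<omega>\<bar> ^ 3) \<le> (\<epsilon> * expectation (\<lambda>\<omega>. Y \<omega> ^ 2) + expectation (\<lambda>\<omega>. Y \<omega> ^ 4) / \<epsilon>) / 2"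
proof -
  have le: "\<bar>y\<bar> ^ 3 \<le> (\<epsilon> * y ^ 2 + y ^ 4 / \<epsilon>) / 2" for y :: real
  proof -
    have "0 \<le> (\<epsilon> * \<bar>y\<bar> - y ^ 2) ^ 2 / \<epsilon>"
      using assms by simp
    also have "\<dots> = \<epsilon> * y ^ 2 + y ^ 4 / \<epsilon> - 2 * \<bar>y\<bar> ^ 3"
    proof -
      have "(\<epsilon> * \<bar>y\<bar> - y ^ 2) ^ 2 = \<epsilon>\<^sup>2 * \<bar>y\<bar> ^ 2 + y ^ 4 - 2 * \<epsilon> * (\<bar>y\<bar> * \<bar>y\<bar> ^ 2)"
        by (simp add: power2_eq_square algebra_simps power4_eq_xxxx)
      moreover have "\<bar>y\<bar> * \<bar>y\<bar> ^ 2 = \<bar>y\<bar> ^ 3"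
        by (simp add: power3_eq_cube power2_eq_square)
      ultimately show ?thesis
        using assms by (simp add: field_simps power2_eq_square)
    qed
    finally show ?thesis by simp
  qed
  have int: "integrable M (\<lambda>\<omega>. (\<epsilon> * Y \<omega> ^ 2 + Y \<omega> ^ 4 / \<epsilon>) / 2)"
    using assms by (intro integrable_divide integrable_add integrable_mult_right) auto
  show *: "integrable M (\<lambda>\<omega>. \<bar>Y \<omega>\<bar> ^ 3)"
  proof (rule Bochner_Integration.integrable_bound[OF int])
    have "norm (\<bar>y\<bar> ^ 3) = \<bar>y\<bar> ^ 3" for y :: real
      by simp
    then show "AE \<omega> in M. norm (\<bar>Y \<omega>\<bar> ^ 3) \<le> norm ((\<epsilon> * Y \<omega> ^ 2 + Y \<omega> ^ 4 / \<epsilon>) / 2)"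
      using order_trans[OF le abs_ge_self] by (simp only: real_norm_def) simp
  qed simp
  have "expectation (\<lambda>\<omega>. \<bar>Y \<omega>\<bar> ^ 3) \<le> expectation (\<lambda>\<omega>. (\<epsilon> * Y \<omega> ^ 2 + Y \<omega> ^ 4 / \<epsilon>) / 2)"
    by (intro integral_mono * int le)
  also have "\<dots> = (\<epsilon> * expectation (\<lambda>\<omega>. Y \<omega> ^ 2) + expectation (\<lambda>\<omega>. Y \<omega> ^ 4) / \<epsilon>) / 2"
    using assms by simp
  finally show "expectation (\<lambda>\<omega>. \<bar>Y \<omega>\<bar> ^ 3) \<le> (\<epsilon> * expectation (\<lambda>\<omega>. Y \<omega> ^ 2) + expectation (\<lambda>\<omega>. Y \<omega> ^ 4) / \<epsilon>) / 2" .
qed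

lemma one_minus_minus_exp_bound:
  fixes x :: real
  assumes "0 \<le> x"
  shows "\<bar>(1 - x) - exp (- x)\<bar> \<le> x\<^sup>2 / 2"
proof -
  have "1 - x \<le> exp (- x)"
    using exp_ge_add_one_self[of "- x"] by simp
  moreover have "exp (- x) \<le> 1 - x + x\<^sup>2 / 2"
  proof -
    have "(\<lambda>x. 1 - x + x\<^sup>2 / 2 - exp (- x)) 0 \<le> (\<lambda>x. 1 - x + x\<^sup>2 / 2 - exp (- x)) x"
    proof (rule DERIV_nonneg_imp_nondecreasing[OF assms])
      fix y assume "0 \<le> y" "y \<le> x"
      have "((\<lambda>x. 1 - x + x\<^sup>2 / 2 - exp (- x)) has_real_derivative (y - 1 + exp (- y))) (at y)"
        by (auto intro!: derivative_eq_intros)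
      moreover have "0 \<le> y - 1 + exp (- y)"
        using exp_ge_add_one_self[of "- y"] by simp
      ultimately show "\<exists>D. ((\<lambda>x. 1 - x + x\<^sup>2 / 2 - exp (- x)) has_real_derivative D) (at y) \<and> 0 \<le> D"
        by blast
    qed
    then show ?thesis by simp
  qed
  ultimately show ?thesis by simp
qed

text \<open>
  By independence the characteristic function of a row sum is the product of those of the entries. Each of
  these differs from \<open>exp (- t\<^sup>2 v\<^sub>n / 2)\<close> by an amount whose \<open>n\<close>-fold multiple tends to 0, and factors of modulus at most 1 can
  be exchanged one by one. The deterministic
  sequence \<open>c\<close> accommodates centrings other than the mean.
\<close>

theorem (in prob_space) lyapunov_clt_triangular:
  fixes Y :: "nat \<Rightarrow> nat \<Rightarrow> 'a \<Rightarrow> real"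
  assumes indep: "\<And>n. n \<ge> 1 \<Longrightarrow> indep_vars (\<lambda>_. borel) (Y n) {1..n}"
    and moment4: "\<And>n i. n \<ge> 1 \<Longrightarrow> i \<in> {1..n} \<Longrightarrow> integrable M (\<lambda>\<omega>. Y n i \<omega> ^ 4)"
    and mean: "\<And>n i. n \<ge> 1 \<Longrightarrow> i \<in> {1..n} \<Longrightarrow> expectation (Y n i) = 0"
    and var: "\<And>n i. n \<ge> 1 \<Longrightarrow> i \<in> {1..n} \<Longrightarrow> expectation (\<lambda>\<omega>. Y n i \<omega> ^ 2) = v n"
    and fourth: "\<And>n i. n \<ge> 1 \<Longrightarrow> i \<in> {1..n} \<Longrightarrow> expectation (\<lambda>\<omega>. Y n i \<omega> ^ 4) \<le> q n"
    and v_lim: "(\<lambda>n. real n * v n) \<longlonglongrightarrow> V" and V: "V > 0"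
    and q_lim: "(\<lambda>n. real n * q n) \<longlonglongrightarrow> 0"
    and c_lim: "c \<longlonglongrightarrow> \<mu>"
    and Z: "\<And>n \<omega>. n \<ge> 1 \<Longrightarrow> Z n \<omega> = (\<Sum>i=1..n. Y n i \<omega>) + c n"
    and Z_meas: "\<And>n. Z n \<in> borel_measurable M"
  shows "tendsto_in_distribution M Z (normal_distribution \<mu> V)"
  unfolding tendsto_in_distribution_def
proof (rule levy_continuity)
  show "real_distribution (distr M borel (Z n))" for n
    using Z_meas by (rule real_distribution_distr)
  show "real_distribution (normal_distribution \<mu> V)"
    by (rule real_distribution_normal[OF V])
  have meas: "Y n i \<in> borel_measurable M" if "n \<ge> 1" "i \<in> {1..n}" for n i
    using indep[OF that(1)] that(2) unfolding indep_vars_def2 by auto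
  have sq_int: "integrable M (\<lambda>\<omega>. Y n i \<omega> ^ 2)" if "n \<ge> 1" "i \<in> {1..n}" for n i
    using meas[OF that] moment4[OF that]
    by - (rule square_integrable_imp_integrable, auto simp: power_mult[symmetric])
  have one_int: "integrable M (Y n i)" if "n \<ge> 1" "i \<in> {1..n}" for n i
    using meas[OF that] sq_int[OF that] by - (rule square_integrable_imp_integrable, auto)
  fix t :: real
  define P where "P n i = char (distr M borel (Y n i)) t" for n i
  have v_nonneg: "v n \<ge> 0" if "n \<ge> 1" for n
    using that by (subst var[of n 1, symmetric]) auto
  have q_nonneg: "q n \<ge> 0" if "n \<ge> 1" for n
    by (rule order_trans[OF _ fourth[of n 1]]) (use that in auto)
  define E where "E n = complex_of_real (exp (- (t\<^sup>2 * v n / 2)))" for n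
  have factor: "norm (P n i - E n) \<le> \<bar>t\<bar> ^ 3 / 12 * (\<epsilon> * v n + q n / \<epsilon>) + (t\<^sup>2 * v n / 2)\<^sup>2 / 2"
    if n: "n \<ge> 1" "i \<in> {1..n}" and \<epsilon>: "\<epsilon> > 0" for n i \<epsilon>
  proof -
    note third = third_moment_le[where Y = "Y n i", OF meas[OF n] sq_int[OF n] moment4[OF n] \<epsilon>]
    have "variance (Y n i) = v n"
      using mean[OF n] var[OF n] by simp
    then have "norm (P n i - (1 - t\<^sup>2 * v n / 2)) \<le>
        (t\<^sup>2 / 6) * expectation (\<lambda>\<omega>. min (6 * (Y n i \<omega>)\<^sup>2) (\<bar>t\<bar> * \<bar>Y n i \<omega>\<bar> ^ 3))"
      unfolding P_def by (rule char_approx3'[where X = "Y n i", OF meas[OF n] one_int[OF n] sq_int[OF n] mean[OF n] _ refl])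
    also have "\<dots> \<le> (t\<^sup>2 / 6) * expectation (\<lambda>\<omega>. \<bar>t\<bar> * \<bar>Y n i \<omega>\<bar> ^ 3)"
      using third(1) sq_int[OF n]
      by (intro mult_left_mono[OF integral_mono] integrable_min integrable_mult_right) auto
    also have "\<dots> \<le> (t\<^sup>2 / 6) * (\<bar>t\<bar> * ((\<epsilon> * v n + q n / \<epsilon>) / 2))"
    proof -
      have "expectation (\<lambda>\<omega>. Y n i \<omega> ^ 4) / \<epsilon> \<le> q n / \<epsilon>"
        using fourth[OF n] \<epsilon> by (simp add: divide_right_mono)
      then have "(\<epsilon> * v n + expectation (\<lambda>\<omega>. Y n i \<omega> ^ 4) / \<epsilon>) / 2 \<le> (\<epsilon> * v n + q n / \<epsilon>) / 2"
        by (rule divide_right_mono[OF add_left_mono]) simp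
      then have "expectation (\<lambda>\<omega>. \<bar>Y n i \<omega>\<bar> ^ 3) \<le> (\<epsilon> * v n + q n / \<epsilon>) / 2"
        by (rule order_trans[OF third(2)[unfolded var[OF n]]])
      then have "\<bar>t\<bar> * expectation (\<lambda>\<omega>. \<bar>Y n i \<omega>\<bar> ^ 3) \<le> \<bar>t\<bar> * ((\<epsilon> * v n + q n / \<epsilon>) / 2)"
        by (rule mult_left_mono) simp
      then show ?thesis
        unfolding integral_mult_right_zero by (rule mult_left_mono) simp
    qed
    also have "\<dots> = \<bar>t\<bar> ^ 3 / 12 * (\<epsilon> * v n + q n / \<epsilon>)"
      by (simp add: power3_eq_cube power2_eq_square)
    finally have 1: "norm (P n i - (1 - t\<^sup>2 * v n / 2)) \<le> \<bar>t\<bar> ^ 3 / 12 * (\<epsilon> * v n + q n / \<epsilon>)" .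
    have "norm (complex_of_real (1 - t\<^sup>2 * v n / 2) - E n) = \<bar>(1 - t\<^sup>2 * v n / 2) - exp (- (t\<^sup>2 * v n / 2))\<bar>"
      unfolding E_def of_real_diff[symmetric] norm_of_real ..
    also have "\<dots> \<le> (t\<^sup>2 * v n / 2)\<^sup>2 / 2"
      using v_nonneg[OF n(1)] by (intro one_minus_minus_exp_bound) auto
    finally have 2: "norm (complex_of_real (1 - t\<^sup>2 * v n / 2) - E n) \<le> (t\<^sup>2 * v n / 2)\<^sup>2 / 2" .
    show ?thesis
      using norm_triangle_mono[OF 1 2] by simp
  qed
  \<comment> \<open>The third moments contribute \<open>\<epsilon> n v\<close> and \<open>n q / \<epsilon>\<close>; with the square root both vanish, and \<open>1 / n\<close> keeps \<open>\<epsilon>\<close> positive when \<open>q = 0\<close>.\<close>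
  define \<epsilon> where "\<epsilon> n = sqrt (real n * q n) + 1 / real n" for n
  define r where "r n = \<bar>t\<bar> ^ 3 / 12 * (\<epsilon> n * (real n * v n) + sqrt (real n * q n)) + t ^ 4 / 8 * (real n * v n)\<^sup>2 / real n" for n
  have prod_bound: "norm (char (distr M borel (\<lambda>\<omega>. \<Sum>i=1..n. Y n i \<omega>)) t - E n ^ n) \<le> r n" if n: "n \<ge> 1" for n
  proof -
    have \<epsilon>: "\<epsilon> n > 0"
      using n q_nonneg[OF n] unfolding \<epsilon>_def by (intro add_nonneg_pos) auto
    have "char (distr M borel (\<lambda>\<omega>. \<Sum>i=1..n. Y n i \<omega>)) t = (\<Prod>i=1..n. P n i)"
      unfolding P_def by (rule char_distr_sum[OF indep[OF n]])
    moreover have "E n ^ n = (\<Prod>i=1..n. E n)"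
      by simp
    moreover have "norm ((\<Prod>i=1..n. P n i) - (\<Prod>i=1..n. E n)) \<le> (\<Sum>i=1..n. norm (P n i - E n))"
    proof (rule norm_prod_diff)
      fix i assume i: "i \<in> {1..n}"
      interpret D: real_distribution "distr M borel (Y n i)"
        using meas[OF n i] by (rule real_distribution_distr)
      show "norm (P n i) \<le> 1"
        unfolding P_def by (rule D.cmod_char_le_1)
      show "norm (E n) \<le> 1"
        using v_nonneg[OF n] by (simp add: E_def)
    qed
    moreover have "(\<Sum>i=1..n. norm (P n i - E n)) \<le> (\<Sum>i=1..n. \<bar>t\<bar> ^ 3 / 12 * (\<epsilon> n * v n + q n / \<epsilon> n) + (t\<^sup>2 * v n / 2)\<^sup>2 / 2)"
      by (intro sum_mono factor n \<epsilon>) auto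
    moreover have "\<dots> = \<bar>t\<bar> ^ 3 / 12 * (\<epsilon> n * (real n * v n) + real n * q n / \<epsilon> n) + t ^ 4 / 8 * (real n * v n)\<^sup>2 / real n"
      using n by (simp add: field_simps power2_eq_square power4_eq_xxxx)
    moreover have "real n * q n / \<epsilon> n \<le> sqrt (real n * q n)"
    proof -
      have "real n * q n = sqrt (real n * q n) * sqrt (real n * q n)"
        using q_nonneg[OF n] by simp
      also have "\<dots> \<le> sqrt (real n * q n) * \<epsilon> n"
        using q_nonneg[OF n] unfolding \<epsilon>_def by (intro mult_left_mono) auto
      finally show ?thesis
        using \<epsilon> by (simp add: divide_le_eq)
    qed
    then have "\<bar>t\<bar> ^ 3 / 12 * (\<epsilon> n * (real n * v n) + real n * q n / \<epsilon> n) \<le> \<bar>t\<bar> ^ 3 / 12 * (\<epsilon> n * (real n * v n) + sqrt (real n * q n))"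
      by (intro mult_left_mono) auto
    ultimately show ?thesis
      unfolding r_def by (simp only:)
  qed
  have r_lim: "r \<longlonglongrightarrow> 0"
  proof -
    have s: "(\<lambda>n. sqrt (real n * q n)) \<longlonglongrightarrow> 0"
      using tendsto_real_sqrt[OF q_lim] by simp
    have e: "\<epsilon> \<longlonglongrightarrow> 0"
      unfolding \<epsilon>_def[abs_def] using tendsto_add[OF s lim_1_over_n] by simp
    have "r \<longlonglongrightarrow> \<bar>t\<bar> ^ 3 / 12 * (0 * V + 0) + t ^ 4 / 8 * V\<^sup>2 * 0"
      unfolding r_def[abs_def] using lim_1_over_n[where 'a = real]
      by (subst divide_inverse, intro tendsto_intros e v_lim s) (simp add: inverse_eq_divide)
    then show ?thesis by simp
  qed
  have "(\<lambda>n. char (distr M borel (\<lambda>\<omega>. \<Sum>i=1..n. Y n i \<omega>)) t - E n ^ n) \<longlonglongrightarrow> 0"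
    by (rule Lim_null_comparison[OF _ r_lim]) (use prod_bound in \<open>auto simp: eventually_at_top_linorder\<close>)
  moreover have "(\<lambda>n. E n ^ n) \<longlonglongrightarrow> of_real (exp (- t\<^sup>2 * V / 2))"
  proof -
    have "E n ^ n = of_real (exp (- t\<^sup>2 * (real n * v n) / 2))" for n
      unfolding E_def of_real_power[symmetric] exp_of_nat_mult[symmetric] by (simp add: mult_ac)
    then show ?thesis
      by (simp only:) (intro tendsto_intros v_lim, simp)
  qed
  ultimately have "(\<lambda>n. char (distr M borel (\<lambda>\<omega>. \<Sum>i=1..n. Y n i \<omega>)) t) \<longlonglongrightarrow> of_real (exp (- t\<^sup>2 * V / 2))"
    by (rule Lim_transform[rotated])
  then have "(\<lambda>n. exp (\<i> * of_real (t * c n)) * char (distr M borel (\<lambda>\<omega>. \<Sum>i=1..n. Y n i \<omega>)) t)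
      \<longlonglongrightarrow> exp (\<i> * of_real (t * \<mu>)) * of_real (exp (- t\<^sup>2 * V / 2))"
    by (intro tendsto_intros c_lim)
  moreover have "char (distr M borel (Z n)) t
      = exp (\<i> * of_real (t * c n)) * char (distr M borel (\<lambda>\<omega>. \<Sum>i=1..n. Y n i \<omega>)) t" if "n \<ge> 1" for n
  proof -
    have "Z n = (\<lambda>\<omega>. 1 * (\<Sum>i=1..n. Y n i \<omega>) + c n)"
      using Z[OF that] by (simp add: fun_eq_iff)
    then show ?thesis
      using char_distr_affine[of "\<lambda>\<omega>. \<Sum>i=1..n. Y n i \<omega>" M 1 "c n" t] meas[OF that] by simp
  qed
  ultimately show "(\<lambda>n. char (distr M borel (Z n)) t) \<longlonglongrightarrow> char (normal_distribution \<mu> V) t"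
    unfolding char_normal_distribution[OF V]
    by (elim Lim_transform_eventually) (auto simp: eventually_at_top_linorder intro!: exI[of _ 1])
qed

section \<open>Asymptotic normality of the estimator\<close>

lemma dirichlet_kernel_fourth_power:
  assumes "s \<in> simplex_int" "b > 0"
  shows "dirichlet_kernel s b x ^ 4 = kernel_energy s b ^ 2 * kernel_energy s (b / 2) * dirichlet_kernel s (b / 4) x"
proof -
  have "dirichlet_kernel s b x ^ 4 = (dirichlet_kernel s b x ^ 2) ^ 2"
    by (simp flip: power_mult)
  then show ?thesis
    using dirichlet_kernel_power2[OF assms] dirichlet_kernel_power2[of s "b / 2" x] assms
    by (simp add: power_mult_distrib)
qed

text \<open>
  Even powers of the kernel are multiples of kernels, so each moment of \<open>K\<^sub>b(X)\<close> is a multiple of a mean of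
  \<open>f\<close> under a kernel with smaller bandwidth.
\<close>

lemma kernel_sample_moments:
  fixes s :: "real ^ 'd" and X :: "'a \<Rightarrow> real ^ 'd"
  assumes X: "distributed M lborel X (\<lambda>x. ennreal (f x))" and f_nonneg: "\<And>x. 0 \<le> f x"
    and f: "simplex_bounded f" and s: "s \<in> simplex_int" and b: "b > 0"
  defines "K \<equiv> \<lambda>\<omega>. dirichlet_kernel s b (X \<omega>)"
  shows "K \<in> borel_measurable M"
    and "integrable M K" "(\<integral>\<omega>. K \<omega> \<partial>M) = kernel_mean s b f"
    and "integrable M (\<lambda>\<omega>. K \<omega> ^ 2)"
        "(\<integral>\<omega>. K \<omega> ^ 2 \<partial>M) = kernel_energy s b * kernel_mean s (b / 2) f"
    and "integrable M (\<lambda>\<omega>. K \<omega> ^ 4)"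
        "(\<integral>\<omega>. K \<omega> ^ 4 \<partial>M) = kernel_energy s b ^ 2 * kernel_energy s (b / 2) * kernel_mean s (b / 4) f"
proof -
  have Xm [measurable]: "X \<in> borel_measurable M"
    using distributed_measurable[OF X] by simp
  note [measurable] = dirichlet_kernel_measurable[OF s b]
  have transfer: "integrable M (\<lambda>\<omega>. c * dirichlet_kernel s h (X \<omega>))"
      "(\<integral>\<omega>. c * dirichlet_kernel s h (X \<omega>) \<partial>M) = c * kernel_mean s h f" if h: "h > 0" for c h
  proof -
    have meas: "(\<lambda>x. c * dirichlet_kernel s h x) \<in> borel_measurable lborel"
      using dirichlet_kernel_measurable[OF s h] by simp
    have "integrable lborel (\<lambda>x. c * (f x * dirichlet_kernel s h x))"
      by (intro integrable_mult_right kernel_mean_integrable s h f)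
    then show "integrable M (\<lambda>\<omega>. c * dirichlet_kernel s h (X \<omega>))"
      using distributed_integrable[OF X meas f_nonneg] by (simp add: mult_ac)
    have "(\<integral>x. f x * (c * dirichlet_kernel s h x) \<partial>lborel) = (\<integral>x. c * (f x * dirichlet_kernel s h x) \<partial>lborel)"
      by (simp add: mult_ac)
    then show "(\<integral>\<omega>. c * dirichlet_kernel s h (X \<omega>) \<partial>M) = c * kernel_mean s h f"
      unfolding distributed_integral[OF X meas f_nonneg, symmetric] by (simp add: kernel_mean_def)
  qed
  show "K \<in> borel_measurable M"
    unfolding K_def by measurable
  show "integrable M K" "(\<integral>\<omega>. K \<omega> \<partial>M) = kernel_mean s b f"
    using transfer[OF b, of 1] by (simp_all add: K_def)
  show "integrable M (\<lambda>\<omega>. K \<omega> ^ 2)" "(\<integral>\<omega>. K \<omega> ^ 2 \<partial>M) = kernel_energy s b * kernel_mean s (b / 2) f"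
    using transfer[of "b / 2"] b by (simp_all only: K_def dirichlet_kernel_power2[OF s b] half_gt_zero)
  have "b / 4 > 0" using b by simp
  then show "integrable M (\<lambda>\<omega>. K \<omega> ^ 4)"
    "(\<integral>\<omega>. K \<omega> ^ 4 \<partial>M) = kernel_energy s b ^ 2 * kernel_energy s (b / 2) * kernel_mean s (b / 4) f"
    using transfer[of "b / 4"] by (simp_all only: K_def dirichlet_kernel_fourth_power[OF s b])
qed

lemma kernel_energy_along:
  fixes s :: "real ^ 'd" and b :: "nat \<Rightarrow> real"
  assumes s: "s \<in> simplex_int" and b: "filterlim b (at_right 0) sequentially"
  shows "(\<lambda>n. b n powr (real CARD('d) / 2) * kernel_energy s (b n)) \<longlonglongrightarrow> psi s"
  using filterlim_compose[OF kernel_energy_asymptotics[OF s] b] by simp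

lemma filterlim_at_right_0:
  fixes b :: "nat \<Rightarrow> real"
  assumes "b \<longlonglongrightarrow> 0" and pos: "\<And>n. n \<ge> 1 \<Longrightarrow> 0 < b n"
  shows "filterlim b (at_right 0) sequentially"
  unfolding filterlim_at
proof
  show "\<forall>\<^sub>F n in sequentially. b n \<in> {0<..} \<and> b n \<noteq> 0"
    using eventually_ge_at_top[of 1]
  proof eventually_elim
    case (elim n)
    then show ?case
      using pos[OF elim] by simp
  qed
qed fact

lemma power4_diff_le: "(x - y) ^ 4 \<le> 8 * (x ^ 4 + y ^ 4)" for x y :: real
proof -
  have sq: "(u + v) ^ 2 \<le> 2 * (u ^ 2 + v ^ 2)" for u v :: real
    using zero_le_power2[of "u - v"] by (simp add: power2_eq_square algebra_simps)
  have "(x - y) ^ 4 = ((x + - y) ^ 2) ^ 2"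
    by (simp flip: power_mult)
  also have "\<dots> \<le> (2 * (x ^ 2 + y ^ 2)) ^ 2"
    using sq[of x "- y"] by (intro power_mono) auto
  also have "\<dots> = 4 * (x ^ 2 + y ^ 2) ^ 2"
    by (simp only: power_mult_distrib) simp
  also have "\<dots> \<le> 4 * (2 * ((x ^ 2) ^ 2 + (y ^ 2) ^ 2))"
    by (intro mult_left_mono sq) auto
  finally show ?thesis
    by (simp flip: power_mult)
qed

text \<open>
  The common core of the three limit theorems: a normalisation \<open>r\<close> whose square is asymptotic to
  \<open>\<kappa> n b\<^sup>d\<^sup>/\<^sup>2\<close>, and a centring \<open>c\<close> for which the scaled bias converges. The summands are
  \<open>Y\<^sub>i = (r / n) (K\<^sub>b(X\<^sub>i) - E K\<^sub>b(X\<^sub>i))\<close>. Written with \<open>\<rho> = r\<^sup>2 / (n b\<^sup>d\<^sup>/\<^sup>2)\<close> and \<open>a = b\<^sup>d\<^sup>/\<^sup>2 A\<^sub>b\<close>, the sum of their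
  variances is a polynomial in convergent sequences, and the bound on the sum of their fourth moments has the
  additional factor \<open>w = 1 / (n b\<^sup>d\<^sup>/\<^sup>2)\<close>, which tends to 0.
\<close>

theorem (in prob_space) dirichlet_kde_clt:
  fixes X :: "nat \<Rightarrow> 'a \<Rightarrow> real ^ 'd" and f :: "real ^ 'd \<Rightarrow> real"
    and b r c :: "nat \<Rightarrow> real" and s :: "real ^ 'd"
  assumes indep: "indep_vars (\<lambda>_. borel) X {1..}"
    and dist: "\<And>i. i \<ge> 1 \<Longrightarrow> distributed M lborel (X i) (\<lambda>x. ennreal (f x))"
    and f_nonneg: "\<And>x. 0 \<le> f x" and f: "simplex_bounded f"
    and f_cont: "(f \<longlongrightarrow> f s) (at s within simplex_set)"
    and b_pos: "\<And>n. n \<ge> 1 \<Longrightarrow> 0 < b n" and b_lim: "b \<longlonglongrightarrow> 0"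
    and s: "s \<in> simplex_int" and fs: "0 < f s"
    and rate: "(\<lambda>n. (r n)\<^sup>2 / real n * b n powr (- (real CARD('d) / 2))) \<longlonglongrightarrow> \<kappa>" and \<kappa>: "\<kappa> > 0"
    and eff: "filterlim (\<lambda>n. real n * b n powr (real CARD('d) / 2)) at_top sequentially"
    and centre: "(\<lambda>n. r n * (kernel_mean s (b n) f - c n)) \<longlonglongrightarrow> \<mu>"
  shows "tendsto_in_distribution M (\<lambda>n \<omega>. r n * (dirichlet_kde X n (b n) s \<omega> - c n))
           (normal_distribution \<mu> (\<kappa> * (psi s * f s)))"
proof -
  define K where "K n i \<omega> = dirichlet_kernel s (b n) (X i \<omega>)" for n i \<omega>
  define m where "m n = kernel_mean s (b n) f" for n
  define q where "q n = r n / real n" for n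
  define Y where "Y n i \<omega> = q n * (K n i \<omega> - m n)" for n i \<omega>
  define E2 where "E2 n = kernel_energy s (b n) * kernel_mean s (b n / 2) f" for n
  define E4 where "E4 n = kernel_energy s (b n) ^ 2 * kernel_energy s (b n / 2) * kernel_mean s (b n / 4) f" for n
  define p where "p n = b n powr (real CARD('d) / 2)" for n
  note mom = kernel_sample_moments[OF dist f_nonneg f s b_pos, folded K_def m_def E2_def E4_def]
  have p_pos: "p n > 0" if "n \<ge> 1" for n
    using b_pos[OF that] by (simp add: p_def)

  have b_right: "filterlim b (at_right 0) sequentially"
    by (rule filterlim_at_right_0[OF b_lim b_pos])
  have b_right': "filterlim (\<lambda>n. b n / k) (at_right 0) sequentially" if "k > 0" for k
    using tendsto_divide[OF b_lim tendsto_const[of k]] b_pos that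
    by (intro filterlim_at_right_0) auto
  have km: "(\<lambda>n. kernel_mean s (b n / k) f) \<longlonglongrightarrow> f s" if "k > 0" for k
    by (rule filterlim_compose[OF kernel_mean_tendsto[OF s f f_cont] b_right'[OF that]])
  have m_lim: "m \<longlonglongrightarrow> f s"
    using km[of 1] by (simp add: m_def[abs_def])
  have p_lim: "p \<longlonglongrightarrow> 0"
  proof -
    have "(\<lambda>n. b n powr (real CARD('d) / 2)) \<longlonglongrightarrow> 0 powr (real CARD('d) / 2)"
      using b_pos by (intro tendsto_powr' b_lim tendsto_const) (auto simp: eventually_at_top_linorder intro!: exI[of _ 1] less_imp_le)
    then show ?thesis by (simp add: p_def[abs_def])
  qed
  define D where "D = 2 powr (real CARD('d) / 2)"
  have D: "D > 0" by (simp add: D_def)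
  define a where "a n = p n * kernel_energy s (b n)" for n
  define a2 where "a2 n = p n / D * kernel_energy s (b n / 2)" for n
  define k2 where "k2 n = kernel_mean s (b n / 2) f" for n
  define k4 where "k4 n = kernel_mean s (b n / 4) f" for n
  define \<rho> where "\<rho> n = (r n)\<^sup>2 / real n / p n" for n
  define w where "w n = 1 / (real n * p n)" for n
  have a_lim: "a \<longlonglongrightarrow> psi s"
    unfolding a_def[abs_def] p_def by (rule kernel_energy_along[OF s b_right])
  have a2_lim: "a2 \<longlonglongrightarrow> psi s"
  proof (rule Lim_transform_eventually)
    show "(\<lambda>n. (b n / 2) powr (real CARD('d) / 2) * kernel_energy s (b n / 2)) \<longlonglongrightarrow> psi s"
      by (rule kernel_energy_along[OF s b_right'[of 2]]) simp
    show "eventually (\<lambda>n. (b n / 2) powr (real CARD('d) / 2) * kernel_energy s (b n / 2) = a2 n) sequentially"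
      using eventually_ge_at_top[of 1]
    proof eventually_elim
      case (elim n)
      show ?case
        using b_pos[OF elim] by (simp add: a2_def p_def D_def powr_divide)
    qed
  qed
  have \<rho>_lim: "\<rho> \<longlonglongrightarrow> \<kappa>"
  proof -
    have "\<rho> n = (r n)\<^sup>2 / real n * b n powr (- (real CARD('d) / 2))" for n
      unfolding \<rho>_def p_def powr_minus by (rule divide_inverse)
    then have "\<rho> = (\<lambda>n. (r n)\<^sup>2 / real n * b n powr (- (real CARD('d) / 2)))"
      by (rule ext)
    then show ?thesis
      using rate by (simp only:)
  qed
  have w_lim: "w \<longlonglongrightarrow> 0"
    unfolding w_def[abs_def] p_def
    by (rule tendsto_divide_0[OF tendsto_const filterlim_at_top_imp_at_infinity[OF eff]])
  have k_lim: "k2 \<longlonglongrightarrow> f s" "k4 \<longlonglongrightarrow> f s"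
    using km[of 2] km[of 4] by (simp_all add: k2_def[abs_def] k4_def[abs_def])
  note lims = a_lim a2_lim \<rho>_lim w_lim k_lim p_lim m_lim

  have int_diff: "integrable M (\<lambda>\<omega>. (K n i \<omega> - m n) ^ 4)" if n: "n \<ge> 1" "i \<in> {1..n}" for n i
  proof (rule Bochner_Integration.integrable_bound)
    show "integrable M (\<lambda>\<omega>. 8 * (K n i \<omega> ^ 4 + m n ^ 4))"
      using mom(6)[of i n] n by auto
    show "(\<lambda>\<omega>. (K n i \<omega> - m n) ^ 4) \<in> borel_measurable M"
      using mom(1)[of i n] n by simp
    show "AE \<omega> in M. norm ((K n i \<omega> - m n) ^ 4) \<le> norm (8 * (K n i \<omega> ^ 4 + m n ^ 4))"
      using power4_diff_le by (intro AE_I2) (simp add: add_nonneg_nonneg)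
  qed
  have psi_pos: "psi s > 0"
  proof -
    have "(\<Prod>i\<in>UNIV. s $ i) > 0"
      using simplex_intD(1)[OF s] by (intro prod_pos) auto
    then show ?thesis
      using simplex_intD(2)[OF s] unfolding psi_def powr_gt_zero
      by (intro less_imp_neq[symmetric] mult_pos_pos) auto
  qed
  show ?thesis
  proof (rule lyapunov_clt_triangular[where Y = Y and v = "\<lambda>n. (q n)\<^sup>2 * (E2 n - (m n)\<^sup>2)"
        and q = "\<lambda>n. q n ^ 4 * (8 * (E4 n + m n ^ 4))" and c = "\<lambda>n. r n * (m n - c n)"])
    fix n :: nat assume n: "n \<ge> 1"
    have "indep_vars (\<lambda>_. borel) X {1..n}"
      by (rule indep_vars_subset[OF indep]) auto
    then have "indep_vars (\<lambda>_. borel) (\<lambda>i \<omega>. q n * (dirichlet_kernel s (b n) (X i \<omega>) - m n)) {1..n}"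
    proof (rule indep_vars_compose2)
      note [measurable] = dirichlet_kernel_measurable[OF s b_pos[OF n]]
      show "(\<lambda>x. q n * (dirichlet_kernel s (b n) x - m n)) \<in> borel_measurable borel" for i
        by measurable
    qed
    then show "indep_vars (\<lambda>_. borel) (Y n) {1..n}"
      by (simp add: Y_def[abs_def] K_def)
    fix i assume i: "i \<in> {1..n}"
    then have i1: "i \<ge> 1" by simp
    note mom = mom[OF i1 n]
    show "integrable M (\<lambda>\<omega>. Y n i \<omega> ^ 4)"
      unfolding Y_def power_mult_distrib by (intro integrable_mult_right int_diff n i)
    show "expectation (Y n i) = 0"
      unfolding Y_def[abs_def] using mom(2,3) by (simp add: prob_space)
    have "(K n i \<omega> - m n)\<^sup>2 = (K n i \<omega>)\<^sup>2 - 2 * m n * K n i \<omega> + (m n)\<^sup>2" for \<omega>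
      by (simp add: power2_diff)
    then have "expectation (\<lambda>\<omega>. (K n i \<omega> - m n)\<^sup>2) = E2 n - 2 * m n * m n + (m n)\<^sup>2"
      using mom(2-5) by (simp add: prob_space)
    then show "expectation (\<lambda>\<omega>. (Y n i \<omega>)\<^sup>2) = (q n)\<^sup>2 * (E2 n - (m n)\<^sup>2)"
      unfolding Y_def power_mult_distrib by (simp add: power2_eq_square)
    have "expectation (\<lambda>\<omega>. (K n i \<omega> - m n) ^ 4) \<le> expectation (\<lambda>\<omega>. 8 * (K n i \<omega> ^ 4 + m n ^ 4))"
      using mom(6) by (intro integral_mono int_diff n i power4_diff_le) auto
    also have "\<dots> = 8 * (E4 n + m n ^ 4)"
      using mom(6,7) by (simp add: prob_space)
    finally show "expectation (\<lambda>\<omega>. Y n i \<omega> ^ 4) \<le> q n ^ 4 * (8 * (E4 n + m n ^ 4))"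
      unfolding Y_def power_mult_distrib by (simp add: mult_left_mono)
  next
    have "(\<lambda>n. \<rho> n * (a n * k2 n - p n * (m n)\<^sup>2)) \<longlonglongrightarrow> \<kappa> * (psi s * f s - 0 * (f s)\<^sup>2)"
      by (intro tendsto_intros lims)
    moreover have "eventually (\<lambda>n. \<rho> n * (a n * k2 n - p n * (m n)\<^sup>2)
        = real n * ((q n)\<^sup>2 * (E2 n - (m n)\<^sup>2))) sequentially"
      using eventually_ge_at_top[of 1]
    proof eventually_elim
      case (elim n)
      have e: "a n * k2 n - p n * (m n)\<^sup>2 = p n * (E2 n - (m n)\<^sup>2)"
        by (simp add: E2_def a_def k2_def algebra_simps)
      show ?case
        unfolding e using p_pos[OF elim] elim by (simp add: \<rho>_def q_def power_divide power2_eq_square)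
    qed
    ultimately show "(\<lambda>n. real n * ((q n)\<^sup>2 * (E2 n - (m n)\<^sup>2))) \<longlonglongrightarrow> \<kappa> * (psi s * f s)"
      using Lim_transform_eventually by fastforce
  next
    have "(\<lambda>n. 8 * (\<rho> n)\<^sup>2 * ((a n)\<^sup>2 * a2 n * k4 n * D + p n ^ 3 * m n ^ 4) * w n)
        \<longlonglongrightarrow> 8 * \<kappa>\<^sup>2 * ((psi s)\<^sup>2 * psi s * f s * D + 0 ^ 3 * f s ^ 4) * 0"
      by (intro tendsto_intros lims)
    moreover have "eventually (\<lambda>n. 8 * (\<rho> n)\<^sup>2 * ((a n)\<^sup>2 * a2 n * k4 n * D + p n ^ 3 * m n ^ 4) * w n
        = real n * (q n ^ 4 * (8 * (E4 n + m n ^ 4)))) sequentially"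
      using eventually_ge_at_top[of 1]
    proof eventually_elim
      case (elim n)
      have e: "(a n)\<^sup>2 * a2 n * k4 n * D + p n ^ 3 * m n ^ 4 = p n ^ 3 * (E4 n + m n ^ 4)"
        using D by (simp add: E4_def a_def a2_def k4_def algebra_simps power2_eq_square power3_eq_cube)
      show ?case
        unfolding e using p_pos[OF elim] elim
        by (simp add: \<rho>_def w_def q_def power_divide power2_eq_square power3_eq_cube power4_eq_xxxx
            mult_ac del: distrib_left_numeral)
    qed
    ultimately show "(\<lambda>n. real n * (q n ^ 4 * (8 * (E4 n + m n ^ 4)))) \<longlonglongrightarrow> 0"
      using Lim_transform_eventually by fastforce
  next
    show "(\<lambda>n. r n * (m n - c n)) \<longlonglongrightarrow> \<mu>"
      using centre by (simp add: m_def)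
    show "0 < \<kappa> * (psi s * f s)"
      using \<kappa> psi_pos fs by simp
    have kde: "dirichlet_kde X n (b n) s \<omega> = 1 / real n * (\<Sum>i=1..n. K n i \<omega>)" for n \<omega>
      by (simp add: dirichlet_kde_def K_def dirichlet_kernel_def)
    show "r n * (dirichlet_kde X n (b n) s \<omega> - c n) = (\<Sum>i=1..n. Y n i \<omega>) + r n * (m n - c n)" if "n \<ge> 1" for n \<omega>
    proof -
      have "(\<Sum>i=1..n. Y n i \<omega>) = q n * ((\<Sum>i=1..n. K n i \<omega>) - real n * m n)"
        by (simp add: Y_def sum_distrib_left[symmetric] sum_subtractf)
      then show ?thesis
        using that by (simp add: kde q_def field_simps)
    qed
    show "(\<lambda>\<omega>. r n * (dirichlet_kde X n (b n) s \<omega> - c n)) \<in> borel_measurable M" for n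
    proof (cases "n \<ge> 1")
      case True
      then have "K n i \<in> borel_measurable M" if "i \<in> {1..n}" for i
        using mom(1)[of i n] that by simp
      then show ?thesis
        unfolding kde by measurable
    next
      case False
      then have "n = 0" by simp
      then show ?thesis
        by (simp add: kde)
    qed
  qed
qed

lemma dirichlet_kde_mean_eq:
  fixes X :: "nat \<Rightarrow> 'a \<Rightarrow> real ^ 'd"
  assumes dist: "\<And>i. i \<ge> 1 \<Longrightarrow> distributed M lborel (X i) (\<lambda>x. ennreal (f x))"
    and f_nonneg: "\<And>x. 0 \<le> f x" and f: "simplex_bounded f"
    and s: "s \<in> simplex_int" and b: "b > 0" and n: "n \<ge> 1"
  shows "dirichlet_kde_mean M X n b s = kernel_mean s b f"
proof -
  note mom = kernel_sample_moments[OF dist f_nonneg f s b]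
  have "dirichlet_kde_mean M X n b s = 1 / real n * (\<Sum>i=1..n. \<integral>\<omega>. dirichlet_kernel s b (X i \<omega>) \<partial>M)"
    unfolding dirichlet_kde_mean_def dirichlet_kde_def dirichlet_kernel_def[symmetric]
    using mom(2) by (simp add: Bochner_Integration.integral_sum)
  also have "\<dots> = kernel_mean s b f"
    using mom(3) n by simp
  finally show ?thesis .
qed

text \<open>
  The first two limits have \<open>r\<^sup>2 = n b\<^sup>d\<^sup>/\<^sup>2\<close> and differ in the centring; in the second the Lipschitz bias
  \<open>O(\<surd>b)\<close> is multiplied by \<open>r\<close> and vanishes. In the third the rate \<open>u = n\<^sup>2\<^sup>/\<^sup>(\<^sup>d\<^sup>+\<^sup>4\<^sup>)\<close> satisfies
  \<open>u\<^sup>d\<^sup>/\<^sup>2 u\<^sup>2 = n\<close>, so both \<open>r\<^sup>2 / (n b\<^sup>d\<^sup>/\<^sup>2) = (u b)\<^sup>-\<^sup>d\<^sup>/\<^sup>2\<close> and the scaled bias are governed by \<open>u b \<longlonglongrightarrow> l\<close>.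
\<close>

theorem theorem5:
  fixes M :: "'a measure"
    and X :: "nat \<Rightarrow> 'a \<Rightarrow> real ^ 'd"
    and f :: "real ^ 'd \<Rightarrow> real"
    and b :: "nat \<Rightarrow> real"
    and s :: "real ^ 'd"
  assumes "prob_space M"
    and "prob_space.indep_vars M (\<lambda>_. borel) X {1..}"
    and "\<forall>i\<ge>1. distributed M lborel (X i) (\<lambda>x. ennreal (f x))"
    and "\<forall>x. 0 \<le> f x"
    and "\<forall>x. x \<notin> simplex_set \<longrightarrow> f x = 0"
    and "\<forall>n\<ge>1. 0 < b n"
    and "b \<longlonglongrightarrow> 0"
    and "s \<in> simplex_int"
    and "0 < f s"
  shows
    "((\<exists>L. L-lipschitz_on simplex_set f) \<longrightarrow>
      filterlim (\<lambda>n. real n powr (1 / 2) * b n powr (real CARD('d) / 4)) at_top sequentially \<longrightarrow>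
        tendsto_in_distribution M
          (\<lambda>n \<omega>. real n powr (1 / 2) * b n powr (real CARD('d) / 4)
             * (dirichlet_kde X n (b n) s \<omega> - dirichlet_kde_mean M X n (b n) s))
          (normal_distribution 0 (psi s * f s))
        \<and> ((\<lambda>n. real n powr (1 / 2) * b n powr (real CARD('d) / 4 + 1 / 2)) \<longlonglongrightarrow> 0 \<longrightarrow>
            tendsto_in_distribution M
              (\<lambda>n \<omega>. real n powr (1 / 2) * b n powr (real CARD('d) / 4)
                 * (dirichlet_kde X n (b n) s \<omega> - f s))
              (normal_distribution 0 (psi s * f s))))
     \<and> (twice_cont_differentiable_on f simplex_set \<longrightarrow>
        (\<forall>l>0. (\<lambda>n. real n powr (2 / (real CARD('d) + 4)) * b n) \<longlonglongrightarrow> l \<longrightarrow>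
          tendsto_in_distribution M
            (\<lambda>n \<omega>. real n powr (2 / (real CARD('d) + 4)) * (dirichlet_kde X n (b n) s \<omega> - f s))
            (normal_distribution (l * bias_coeff f s)
               (l powr (- real CARD('d) / 2) * psi s * f s))))"
proof -
  interpret prob_space M by fact
  have dist: "distributed M lborel (X i) (\<lambda>x. ennreal (f x))" if "i \<ge> 1" for i
    using assms(3) that by blast
  have f_nonneg: "0 \<le> f x" for x using assms(4) by blast
  have b_pos: "0 < b n" if "n \<ge> 1" for n using assms(6) that by blast
  note b_lim = assms(7) and s = assms(8) and fs = assms(9)
  have s_in: "s \<in> simplex_set"
    using simplex_int_subset_interior[OF s] interior_subset by blast
  have f_meas: "f \<in> borel_measurable borel"
    using distributed_real_measurable[OF f_nonneg dist[of 1]] by simp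
  have b_right: "filterlim b (at_right 0) sequentially"
    by (rule filterlim_at_right_0[OF b_lim b_pos])
  let ?d = "real CARD('d)"
  have cont: "simplex_bounded f" "(f \<longlongrightarrow> f s) (at s within simplex_set)" if "continuous_on simplex_set f"
    using that s_in by (auto intro!: simplex_bounded_on f_meas simp: continuous_on_def)
  note clt = dirichlet_kde_clt[OF assms(2) dist f_nonneg _ _ b_pos b_lim s fs]
  have half: "(real n powr (1 / 2) * b n powr (?d / 4))\<^sup>2 = real n * b n powr (?d / 2)" for n
  proof -
    have "(x powr a)\<^sup>2 = x powr (a + a)" for x a :: real
      by (simp only: power2_eq_square powr_add)
    then show ?thesis
      by (simp add: power_mult_distrib)
  qed

  have part1: "tendsto_in_distribution M
      (\<lambda>n \<omega>. real n powr (1 / 2) * b n powr (?d / 4) * (dirichlet_kde X n (b n) s \<omega> - c n))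
      (normal_distribution 0 (psi s * f s))"
    if f: "continuous_on simplex_set f"
      and eff: "filterlim (\<lambda>n. real n powr (1 / 2) * b n powr (?d / 4)) at_top sequentially"
      and c: "(\<lambda>n. real n powr (1 / 2) * b n powr (?d / 4) * (kernel_mean s (b n) f - c n)) \<longlonglongrightarrow> 0" for c
  proof -
    have "tendsto_in_distribution M
      (\<lambda>n \<omega>. real n powr (1 / 2) * b n powr (?d / 4) * (dirichlet_kde X n (b n) s \<omega> - c n))
      (normal_distribution 0 (1 * (psi s * f s)))"
    proof (rule clt[OF _ cont[OF f] _ _ _ _ c])
      show "(\<lambda>n. (real n powr (1 / 2) * b n powr (?d / 4))\<^sup>2 / real n * b n powr (- (?d / 2))) \<longlonglongrightarrow> 1"
      proof (rule Lim_transform_eventually[OF tendsto_const])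
        show "eventually (\<lambda>n. 1 = (real n powr (1 / 2) * b n powr (?d / 4))\<^sup>2 / real n * b n powr (- (?d / 2))) sequentially"
          using eventually_ge_at_top[of 1]
        proof eventually_elim
          case (elim n)
          then show ?case
            unfolding half using b_pos[OF elim] by (simp add: powr_minus)
        qed
      qed
      show "filterlim (\<lambda>n. real n * b n powr (?d / 2)) at_top sequentially"
        unfolding half[symmetric] using eff by (rule filterlim_pow_at_top[rotated]) simp
    qed auto
    then show ?thesis by simp
  qed

  show ?thesis
  proof (intro conjI impI allI; (elim exE)?)
    fix L assume L: "L-lipschitz_on simplex_set f"
      and eff: "filterlim (\<lambda>n. real n powr (1 / 2) * b n powr (?d / 4)) at_top sequentially"
    have f: "continuous_on simplex_set f"
      using L by (rule lipschitz_on_continuous_on)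
    show "tendsto_in_distribution M
          (\<lambda>n \<omega>. real n powr (1 / 2) * b n powr (?d / 4)
             * (dirichlet_kde X n (b n) s \<omega> - dirichlet_kde_mean M X n (b n) s))
          (normal_distribution 0 (psi s * f s))"
    proof (rule part1[OF f eff])
      show "(\<lambda>n. real n powr (1 / 2) * b n powr (?d / 4) * (kernel_mean s (b n) f - dirichlet_kde_mean M X n (b n) s)) \<longlonglongrightarrow> 0"
        by (rule Lim_transform_eventually[OF tendsto_const])
           (use dirichlet_kde_mean_eq[OF dist f_nonneg cont(1)[OF f] s b_pos] in \<open>auto simp: eventually_at_top_linorder intro!: exI[of _ 1]\<close>)
    qed
    assume small: "(\<lambda>n. real n powr (1 / 2) * b n powr (?d / 4 + 1 / 2)) \<longlonglongrightarrow> 0"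
    show "tendsto_in_distribution M
              (\<lambda>n \<omega>. real n powr (1 / 2) * b n powr (?d / 4) * (dirichlet_kde X n (b n) s \<omega> - f s))
              (normal_distribution 0 (psi s * f s))"
    proof (rule part1[OF f eff])
      obtain C where "eventually (\<lambda>b. \<bar>kernel_mean s b f - f s\<bar> \<le> C * sqrt b) (at_right 0)"
        using kernel_bias_lipschitz[OF s cont(1)[OF f] L] by blast
      then have "eventually (\<lambda>n. \<bar>kernel_mean s (b n) f - f s\<bar> \<le> C * sqrt (b n)) sequentially"
        by (rule eventually_compose_filterlim[OF _ b_right])
      then have "eventually (\<lambda>n. norm (real n powr (1 / 2) * b n powr (?d / 4) * (kernel_mean s (b n) f - f s))
          \<le> C * (real n powr (1 / 2) * b n powr (?d / 4 + 1 / 2))) sequentially"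
        using eventually_ge_at_top[of 1]
      proof eventually_elim
        case (elim n)
        have "real n powr (1 / 2) * b n powr (?d / 4) * \<bar>kernel_mean s (b n) f - f s\<bar>
            \<le> real n powr (1 / 2) * b n powr (?d / 4) * (C * sqrt (b n))"
          using elim(1) by (rule mult_left_mono) simp
        then show ?case
          using b_pos[OF elim(2)] by (simp add: abs_mult powr_add powr_half_sqrt mult_ac)
      qed
      then show "(\<lambda>n. real n powr (1 / 2) * b n powr (?d / 4) * (kernel_mean s (b n) f - f s)) \<longlonglongrightarrow> 0"
        by (rule Lim_null_comparison) (rule tendsto_mult_right_zero[OF small])
    qed
  next
    fix l :: real
    assume C2: "twice_cont_differentiable_on f simplex_set" and l: "0 < l"
      and bw: "(\<lambda>n. real n powr (2 / (?d + 4)) * b n) \<longlonglongrightarrow> l"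
    have f: "continuous_on simplex_set f"
      using C2 unfolding twice_cont_differentiable_on_def continuous_on_eq_continuous_within
      by (blast intro: has_derivative_continuous)
    define u where "u n = real n powr (2 / (?d + 4))" for n
    have u_top: "filterlim u at_top sequentially"
      unfolding u_def by real_asymp
    have u_pos: "u n > 0" if "n \<ge> 1" for n
      using that by (simp add: u_def)
    have u_pow: "u n powr (?d / 2) * (u n)\<^sup>2 = real n" if "n \<ge> 1" for n
    proof -
      have "u n powr (?d / 2) * (u n)\<^sup>2 = real n powr (2 / (?d + 4) * (?d / 2) + (2 / (?d + 4) + 2 / (?d + 4)))"
        by (simp only: u_def power2_eq_square powr_powr powr_add)
      also have "2 / (?d + 4) * (?d / 2) + (2 / (?d + 4) + 2 / (?d + 4)) = 1"
        by (simp add: field_simps add_nonneg_eq_0_iff)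
      finally show ?thesis
        using that by simp
    qed
    have "tendsto_in_distribution M (\<lambda>n \<omega>. u n * (dirichlet_kde X n (b n) s \<omega> - f s))
            (normal_distribution (l * bias_coeff f s) (l powr (- (?d / 2)) * (psi s * f s)))"
    proof (rule clt[OF _ cont[OF f]])
      have "(\<lambda>n. (u n * b n) powr (- (?d / 2))) \<longlonglongrightarrow> l powr (- (?d / 2))"
        using bw l unfolding u_def by (intro tendsto_intros) auto
      then show "(\<lambda>n. (u n)\<^sup>2 / real n * b n powr (- (?d / 2))) \<longlonglongrightarrow> l powr (- (?d / 2))"
      proof (rule Lim_transform_eventually)
        show "eventually (\<lambda>n. (u n * b n) powr (- (?d / 2)) = (u n)\<^sup>2 / real n * b n powr (- (?d / 2))) sequentially"
          using eventually_ge_at_top[of 1]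
        proof eventually_elim
          case (elim n)
          then show ?case
            using u_pos[OF elim] b_pos[OF elim] unfolding u_pow[OF elim, symmetric]
            by (simp add: powr_mult powr_minus divide_simps)
        qed
      qed
      show "l powr (- (?d / 2)) > 0"
        using l by simp
      have "(\<lambda>n. (u n * b n) powr (?d / 2)) \<longlonglongrightarrow> l powr (?d / 2)"
        using bw l unfolding u_def by (intro tendsto_intros) auto
      then have "filterlim (\<lambda>n. (u n * b n) powr (?d / 2) * (u n)\<^sup>2) at_top sequentially"
        using l by (intro filterlim_tendsto_pos_mult_at_top[of _ "l powr (?d / 2)"] filterlim_pow_at_top u_top) auto
      moreover have "eventually (\<lambda>n. (u n * b n) powr (?d / 2) * (u n)\<^sup>2 = real n * b n powr (?d / 2)) sequentially"
        using eventually_ge_at_top[of 1]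
      proof eventually_elim
        case (elim n)
        then show ?case
          using u_pos[OF elim] b_pos[OF elim] unfolding u_pow[OF elim, symmetric]
          by (simp add: powr_mult mult_ac)
      qed
      ultimately show "filterlim (\<lambda>n. real n * b n powr (?d / 2)) at_top sequentially"
        by (simp cong: filterlim_cong)
      have "(\<lambda>n. (u n * b n) * ((kernel_mean s (b n) f - f s) / b n)) \<longlonglongrightarrow> l * bias_coeff f s"
        using bw unfolding u_def
        by (intro tendsto_mult filterlim_compose[OF kernel_bias_C2[OF s cont(1)[OF f] C2] b_right])
      then show "(\<lambda>n. u n * (kernel_mean s (b n) f - f s)) \<longlonglongrightarrow> l * bias_coeff f s"
      proof (rule Lim_transform_eventually)
        show "eventually (\<lambda>n. (u n * b n) * ((kernel_mean s (b n) f - f s) / b n)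
            = u n * (kernel_mean s (b n) f - f s)) sequentially"
          using eventually_ge_at_top[of 1]
        proof eventually_elim
          case (elim n)
          then show ?case
            using b_pos[OF elim] by simp
        qed
      qed
    qed auto
    then show "tendsto_in_distribution M
            (\<lambda>n \<omega>. real n powr (2 / (?d + 4)) * (dirichlet_kde X n (b n) s \<omega> - f s))
            (normal_distribution (l * bias_coeff f s) (l powr (- ?d / 2) * psi s * f s))"
      by (simp add: u_def mult.assoc)
  qed
qed

end
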